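(* $\mathrm{BLinIneq} \leq_2 \lceil \langle \mathrm{rDiv} \rangle^z \rceil_{z \in \mathbb{N}}$; that is, finding a solution of a solvable system of linear inequalities with solution vector bounded in $[0,1]^m$ is reducible to the supremum over $z$ of the $z$-fold products of robust division.
   Context: Representation of reals. Fix a bijection $\nu:\mathbb{N}\to\mathbb{Q}$ with $\nu(0)=0$ such that the usual operations on $\mathbb{Q}$ are computable with respect to $\nu$. A sequence $w\in\mathbb{N}^{\mathbb{N}}$ is a $\rho$-name of $x\in\mathbb{R}$, written $\rho(w)=x$, if $|\nu(w(i))-x|\le 2^{-i}$ for all $i\in\mathbb{N}$. A $\rho^k$-name of a vector in $\mathbb{R}^k$ is a $k$-tuple of $\rho$-names of its entries. Problems and reducibility. $\mathbb{N}^{\mathbb{N}}$ carries its usual (Baire) topology, countable sets such as $\mathbb{N}$ or finite sets are discrete, products carry the product topology. A problem (multi-valued function) $P$ has a domain $\mathrm{dom}(P)$ of inputs (names) and assigns to each input a nonempty set of admissible outputs (names); $P$ is identified with the set of its choice functions, i.e. all functions $f$ on $\mathrm{dom}(P)$ with $f(w)$ admissible for every $w$. $P\le_2 Q$ holds iff there are continuous partial functions $F,G$ such that for each $g\in Q$ the function $w\mapsto F(w,g(G(w)))$ belongs to $P$ (in particular is defined on $\mathrm{dom}(P)$). Products and suprema. $\langle P,Q\rangle$ is the problem with inputs $(x,u)\in \mathrm{dom}(P)\times\mathrm{dom}(Q)$ and admissible outputs all pairs $(y,v)$ with $y$ admissible for $x$ in $P$ and $v$ admissible for $u$ in $Q$;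 $\langle P\rangle^1=P$, $\langle P\rangle^{z+1}=\langle P,\langle P\rangle^z\rangle$, $z\ge1$. For a countable family $(P_i)$, $\lceil P_i\rceil_i$ denotes its supremum with respect to $\le_2$, realized by the problem with inputs $(i,w)$, $w\in\mathrm{dom}(P_i)$, and the admissible outputs of $P_i$ on $w$. Robust division. $\mathrm{rDiv}$ is the set of functions $d$ defined on $\{(u,v)\mid 0\le\rho(u)\le\rho(v)\}$ (pairs of $\rho$-names), whose values are $\rho$-names of real numbers, satisfying $\rho(d(u,v))=\rho(u)/\rho(v)$ whenever $\rho(v)>0$ (the value is an arbitrary real if $\rho(v)=0$). Linear inequalities. $\mathrm{BLinIneq}_{nm}$ is the problem: given a $\rho^{nm}$-name of a real $n\times m$ matrix $A$ and a $\rho^n$-name of a vector $b\in\mathbb{R}^n$ such that there is a $v\in\mathbb{R}^m$ with $Av\le b$ and $0\le v\le1$ (componentwise), find a $\rho^m$-name of such a $v$. For simplicity it is assumed that the system $Av\le b$ always contains the inequalities $0\le v\le1$. $\mathrm{BLinIneq}$ is the problem without fixed $n,m$, i.e. the supremum $\lceil\mathrm{BLinIneq}_{nm}\rceil_{n,m}$. *)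

theory Defs
  imports
    "HOL-Analysis.Function_Topology"
    "HOL-Library.FuncSet"
    "Jordan_Normal_Form.Matrix"
begin

section \<open>Representation of the reals\<close>

text \<open>
  The total recursive functions, given by the arity and a function on argument lists (only lists
  of that length matter).  Minimisation is restricted to regular functions.
\<close>

inductive recursive_fn :: "nat \<Rightarrow> (nat list \<Rightarrow> nat) \<Rightarrow> bool" where
  zero: "recursive_fn k (\<lambda>_. 0)"
| succ: "recursive_fn 1 (\<lambda>xs. Suc (hd xs))"
| proj: "i < k \<Longrightarrow> recursive_fn k (\<lambda>xs. xs ! i)"
| comp: "recursive_fn (length gs) f \<Longrightarrow> (\<forall>g \<in> set gs. recursive_fn k g)
    \<Longrightarrow> recursive_fn k (\<lambda>xs. f (map (\<lambda>g. g xs) gs))"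
| prec: "recursive_fn k f \<Longrightarrow> recursive_fn (Suc (Suc k)) g
    \<Longrightarrow> recursive_fn (Suc k)
          (\<lambda>xs. rec_nat (f (tl xs)) (\<lambda>i r. g (i # r # tl xs)) (hd xs))"
| mini: "recursive_fn (Suc k) f \<Longrightarrow> (\<forall>xs. length xs = k \<longrightarrow> (\<exists>y. f (y # xs) = 0))
    \<Longrightarrow> recursive_fn k (\<lambda>xs. LEAST y. f (y # xs) = 0)"

definition computable_rat_op :: "(nat \<Rightarrow> rat) \<Rightarrow> (rat \<Rightarrow> rat \<Rightarrow> rat) \<Rightarrow> bool" where
  "computable_rat_op \<nu> op \<longleftrightarrow>
     (\<exists>f. recursive_fn 2 f \<and> (\<forall>i j. \<nu> (f [i, j]) = op (\<nu> i) (\<nu> j)))"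

text \<open>
  Division is total with value 0 at divisor 0, which does not affect computability.  The order
  need not be listed: for a bijective numbering it is decidable once the field operations
  are computable.
\<close>

definition rat_numbering :: "(nat \<Rightarrow> rat) \<Rightarrow> bool" where
  "rat_numbering \<nu> \<longleftrightarrow> bij \<nu> \<and> \<nu> 0 = 0 \<and>
     computable_rat_op \<nu> (+) \<and> computable_rat_op \<nu> (-) \<and>
     computable_rat_op \<nu> (*) \<and> computable_rat_op \<nu> (/)"

text \<open>
  The Baire space.  The type class instance for functions is the product topology, and
  \<^typ>\<open>nat\<close> is discrete.
\<close>

type_synonym baire = "nat \<Rightarrow> nat"

definition rho_name :: "(nat \<Rightarrow> rat) \<Rightarrow> baire \<Rightarrow> real \<Rightarrow> bool" where
  "rho_name \<nu> w x \<longleftrightarrow> (\<forall>i. \<bar>of_rat (\<nu> (w i)) - x\<bar> \<le> 1 / 2 ^ i)"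

text \<open>
  Tuples of a length that is not fixed by the type are functions that are constantly
  \<^const>\<open>undefined\<close> outside the index set.  The subspace of these functions is homeomorphic to
  the finite product.
\<close>

definition vec_name :: "(nat \<Rightarrow> rat) \<Rightarrow> nat \<Rightarrow> (nat \<Rightarrow> baire) \<Rightarrow> real vec \<Rightarrow> bool" where
  "vec_name \<nu> k W v \<longleftrightarrow>
     W \<in> extensional {..<k} \<and> v \<in> carrier_vec k \<and> (\<forall>i<k. rho_name \<nu> (W i) (v $ i))"

definition mat_name ::
  "(nat \<Rightarrow> rat) \<Rightarrow> nat \<Rightarrow> nat \<Rightarrow> (nat \<times> nat \<Rightarrow> baire) \<Rightarrow> real mat \<Rightarrow> bool" where
  "mat_name \<nu> n m W A \<longleftrightarrow>
     W \<in> extensional ({..<n} \<times> {..<m}) \<and> A \<in> carrier_mat n m \<and>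
     (\<forall>i<n. \<forall>j<m. rho_name \<nu> (W (i, j)) (A $$ (i, j)))"


section \<open>Problems and reducibility\<close>

text \<open>
  A problem assigns to each input its set of admissible outputs; the inputs outside its domain
  are those that have none.
\<close>

type_synonym ('a, 'b) problem = "'a \<Rightarrow> 'b set"

definition pdom :: "('a, 'b) problem \<Rightarrow> 'a set" where
  "pdom P = {w. P w \<noteq> {}}"

text \<open>
  Choice functions are total in the logic; their values outside the domain are irrelevant.
\<close>

definition choice_fns :: "('a, 'b) problem \<Rightarrow> ('a \<Rightarrow> 'b) set" where
  "choice_fns P = {f. \<forall>w \<in> pdom P. f w \<in> P w}"

text \<open>
  The partial functions are given by total ones together with their domains \<open>DF\<close> and \<open>DG\<close>.
\<close>

definition reducible2 ::
  "('a::topological_space, 'b::topological_space) problem \<Rightarrow>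
   ('c::topological_space, 'd::topological_space) problem \<Rightarrow> bool"  (infix "\<le>\<^sub>2" 50) where
  "P \<le>\<^sub>2 Q \<longleftrightarrow>
     (\<exists>(F :: 'a \<times> 'd \<Rightarrow> 'b) DF (G :: 'a \<Rightarrow> 'c) DG.
        continuous_on DF F \<and> continuous_on DG G \<and>
        (\<forall>g \<in> choice_fns Q. \<forall>w \<in> pdom P.
           w \<in> DG \<and> G w \<in> pdom Q \<and> (w, g (G w)) \<in> DF \<and> F (w, g (G w)) \<in> P w))"

definition problem_prod ::
  "('a, 'b) problem \<Rightarrow> ('c, 'd) problem \<Rightarrow> ('a \<times> 'c, 'b \<times> 'd) problem" where
  "problem_prod P Q = (\<lambda>(x, u). P x \<times> Q u)"

text \<open>
  The \<open>z\<close>-fold product, where a pair \<open>(x, u)\<close> of a first component and a remaining tuple is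
  stored as the tuple \<open>case_nat x u\<close>.  The \<open>0\<close>-fold product is the one-point problem and only
  starts the recursion.
\<close>

primrec problem_power :: "('a, 'b) problem \<Rightarrow> nat \<Rightarrow> (nat \<Rightarrow> 'a, nat \<Rightarrow> 'b) problem" where
  "problem_power P 0 = (\<lambda>w. if w = (\<lambda>_. undefined) then {\<lambda>_. undefined} else {})"
| "problem_power P (Suc z) =
     (\<lambda>w. (\<lambda>(y, v). case_nat y v) `
            problem_prod P (problem_power P z) (w 0, \<lambda>i. w (Suc i)))"

text \<open>
  The supremum over an index set.  It is to be used with countable index types that carry the
  discrete topology.
\<close>

definition problem_sup ::
  "'i set \<Rightarrow> ('i \<Rightarrow> ('a, 'b) problem) \<Rightarrow> ('i \<times> 'a, 'b) problem" where
  "problem_sup I P = (\<lambda>(i, w). if i \<in> I then P i w else {})"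


section \<open>Robust division and bounded linear inequalities\<close>

definition rDiv :: "(nat \<Rightarrow> rat) \<Rightarrow> (baire \<times> baire, baire) problem" where
  "rDiv \<nu> = (\<lambda>(u, v). {d. \<exists>x y q. rho_name \<nu> u x \<and> rho_name \<nu> v y \<and> 0 \<le> x \<and> x \<le> y \<and>
                              rho_name \<nu> d q \<and> (y > 0 \<longrightarrow> q = x / y)})"

text \<open>
  The matrix is not required to contain the rows that express \<open>0 \<le> v \<le> 1\<close>.  Requiring them
  only restricts the domain, see \<open>reducible2_restrict\<close> below.
\<close>

definition BLinIneq_fixed ::
  "(nat \<Rightarrow> rat) \<Rightarrow> nat \<Rightarrow> nat \<Rightarrow>
   ((nat \<times> nat \<Rightarrow> baire) \<times> (nat \<Rightarrow> baire), nat \<Rightarrow> baire) problem" where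
  "BLinIneq_fixed \<nu> n m = (\<lambda>(U, W). {V. \<exists>A b v.
     mat_name \<nu> n m U A \<and> vec_name \<nu> n W b \<and>
     A *\<^sub>v v \<le> b \<and> 0\<^sub>v m \<le> v \<and> v \<le> vec m (\<lambda>_. 1) \<and> vec_name \<nu> m V v})"

definition BLinIneq ::
  "(nat \<Rightarrow> rat) \<Rightarrow>
   ((nat \<times> nat) \<times> ((nat \<times> nat \<Rightarrow> baire) \<times> (nat \<Rightarrow> baire)), nat \<Rightarrow> baire) problem" where
  "BLinIneq \<nu> = problem_sup UNIV (\<lambda>(n, m). BLinIneq_fixed \<nu> n m)"


section \<open>Basic facts\<close>

lemma reducible2_restrict:
  assumes "P \<le>\<^sub>2 Q"
  shows "(\<lambda>w. if w \<in> D then P w else {}) \<le>\<^sub>2 Q"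
proof -
  have "pdom (\<lambda>w. if w \<in> D then P w else {}) = pdom P \<inter> D"
    by (auto simp: pdom_def)
  then show ?thesis
    using assms unfolding reducible2_def by (simp add: Ball_def) blast
qed

lemma rho_name_unique:
  assumes "rho_name \<nu> w x" "rho_name \<nu> w y"
  shows "x = y"
proof (rule ccontr)
  assume "x \<noteq> y"
  then obtain i where "(1 / 2) ^ i < \<bar>x - y\<bar> / 2"
    using real_arch_pow_inv[of "\<bar>x - y\<bar> / 2" "1 / 2"] by auto
  then have "1 / 2 ^ i < \<bar>x - y\<bar> / 2"
    by (simp add: power_one_over)
  moreover have "\<bar>of_rat (\<nu> (w i)) - x\<bar> \<le> 1 / 2 ^ i" "\<bar>of_rat (\<nu> (w i)) - y\<bar> \<le> 1 / 2 ^ i"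
    using assms by (auto simp: rho_name_def)
  ultimately show False by argo
qed

lemma ex_rho_name:
  assumes "bij \<nu>"
  shows "\<exists>w. rho_name \<nu> w x"
proof -
  have "\<exists>k. \<bar>of_rat (\<nu> k) - x\<bar> \<le> 1 / 2 ^ i" for i :: nat
  proof -
    obtain q :: rat where q: "x < of_rat q" "of_rat q < x + 1 / 2 ^ i"
      using of_rat_dense[of x "x + 1 / 2 ^ i"] by auto
    obtain k where "\<nu> k = q"
      using assms by (metis bij_pointE)
    then show ?thesis using q by (intro exI[of _ k]) auto
  qed
  then show ?thesis unfolding rho_name_def by metis
qed

lemma pdom_problem_prod: "pdom (problem_prod P Q) = pdom P \<times> pdom Q"
  by (auto simp: pdom_def problem_prod_def)

lemma problem_power_eq:
  "problem_power P z w =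
     (if w \<in> extensional {..<z} then (\<Pi>\<^sub>E i\<in>{..<z}. P (w i)) else {})"
proof (induction z arbitrary: w)
  case 0
  then show ?case by (auto simp: extensional_def)
next
  case (Suc z)
  have extens: "u \<in> extensional {..<Suc z} \<longleftrightarrow> (\<lambda>i. u (Suc i)) \<in> extensional {..<z}"
    for u :: "nat \<Rightarrow> 'c"
    by (auto simp: extensional_def) (metis Suc_less_eq not_less_zero old.nat.exhaust zero_less_Suc)
  have split: "(\<forall>i<Suc z. R i) \<longleftrightarrow> R 0 \<and> (\<forall>i<z. R (Suc i))" for R
    by (metis Suc_less_eq less_Suc_eq_0_disj)
  have surj: "f \<in> (\<lambda>(y, v). case_nat y v) ` (Y \<times> V) \<longleftrightarrow> f 0 \<in> Y \<and> (\<lambda>i. f (Suc i)) \<in> V"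
    for f :: "nat \<Rightarrow> 'c" and Y V
  proof
    assume "f 0 \<in> Y \<and> (\<lambda>i. f (Suc i)) \<in> V"
    moreover have "f = case_nat (f 0) (\<lambda>i. f (Suc i))"
      by (rule ext) (simp split: nat.split)
    ultimately show "f \<in> (\<lambda>(y, v). case_nat y v) ` (Y \<times> V)"
      by (metis (no_types, lifting) SigmaI case_prod_conv image_eqI)
  qed auto
  show ?case
    by (auto simp: Suc surj problem_prod_def extens PiE_def Pi_def split Ball_def)
qed

lemma pdom_rDiv:
  assumes "bij \<nu>"
  shows "pdom (rDiv \<nu>) =
    {(u, v). \<exists>x y. rho_name \<nu> u x \<and> rho_name \<nu> v y \<and> 0 \<le> x \<and> x \<le> y}"
  using ex_rho_name[OF assms] by (fastforce simp: pdom_def rDiv_def)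

lemma ex_vec_name:
  assumes "bij \<nu>" "v \<in> carrier_vec k"
  shows "\<exists>W. vec_name \<nu> k W v"
proof -
  obtain f where "rho_name \<nu> (f x) x" for x
    using ex_rho_name[OF assms(1)] by metis
  then have "vec_name \<nu> k (\<lambda>i\<in>{..<k}. f (v $ i)) v"
    using assms(2) by (simp add: vec_name_def)
  then show ?thesis by blast
qed

lemma pdom_BLinIneq_fixed:
  assumes "bij \<nu>"
  shows "pdom (BLinIneq_fixed \<nu> n m) =
    {(U, W). \<exists>A b. mat_name \<nu> n m U A \<and> vec_name \<nu> n W b \<and>
       (\<exists>v \<in> carrier_vec m. A *\<^sub>v v \<le> b \<and> 0\<^sub>v m \<le> v \<and> v \<le> vec m (\<lambda>_. 1))}"
proof -
  have "vec_name \<nu> m V v \<Longrightarrow> v \<in> carrier_vec m" for V v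
    by (simp add: vec_name_def)
  then show ?thesis
    using ex_vec_name[OF assms] unfolding pdom_def BLinIneq_fixed_def by fast
qed

end

theory Submission
  imports Defs "HOL-Analysis.Function_Metric"
begin

text \<open>
  Up to finitely many polynomials in the data, the parameter space is stratified: stratum \<open>l\<close>
  consists of the instances at which exactly \<open>l\<close> of the polynomials (denominators and residuals of
  candidate vertices) do not vanish. On a stratum all signs are locally constant, so the list of
  vertices of the solution polytope \<open>P w\<close> is continuous there. A list \<open>V\<^sub>l\<close> that is continuous on
  the open union \<open>U\<^sub>l\<close> of the strata \<open>\<ge> l\<close> and a function \<open>d\<^sub>l \<ge> 0\<close> that is positive exactly on
  \<open>U\<^sub>l\<close> give continuous robust divisions \<open>d\<^sub>l V\<^sub>l / d\<^sub>l\<close>, whose answers are correct on \<open>U\<^sub>l\<close> and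
  arbitrary elsewhere. All these divisions are independent of each other.

  Choose \<open>V\<^sub>l\<close> to be the vertex list on stratum \<open>l\<close>, and \<open>\<epsilon>\<^sub>l\<close> continuous on \<open>U\<^sub>l\<close>, zero on
  stratum \<open>l\<close>, and larger than the distance of any point of \<open>P w\<close> from the hull of \<open>V\<^sub>l w\<close>.
  Let \<open>\<phi>\<^sub>l\<close> move a point to the nearest point of that hull and back by at most \<open>\<epsilon>\<^sub>l\<close>. If \<open>w\<close> is in
  stratum \<open>l\<close>, then \<open>\<phi>\<^sub>l\<close> maps everything into \<open>P w\<close>, and \<open>\<phi>\<^sub>k\<close> is the identity on \<open>P w\<close> for
  \<open>k < l\<close>. Hence \<open>\<phi>\<^sub>0 (\<phi>\<^sub>1 (\<dots> (\<phi>\<^sub>N 0)))\<close> is a solution although the maps \<open>\<phi>\<^sub>k\<close> with \<open>k > l\<close>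
  are computed from arbitrary answers; it depends continuously on the answers because the nearest
  point depends continuously on the list.
\<close>

section \<open>Zero-dimensional name spaces\<close>

definition agree :: "('a \<Rightarrow> nat \<Rightarrow> nat) \<Rightarrow> nat \<Rightarrow> 'a \<Rightarrow> 'a \<Rightarrow> bool" where
  "agree h n x y \<longleftrightarrow> (\<forall>i<n. h x i = h y i)"

text \<open>Continuity of \<open>h\<close> makes the cylinders open, and the second clause makes
  them a base. All later continuity arguments then ask how many code entries have to be
  read.\<close>

definition cylinder_base :: "('a::topological_space \<Rightarrow> nat \<Rightarrow> nat) \<Rightarrow> bool" where
  "cylinder_base h \<longleftrightarrow>
     continuous_on UNIV h \<and> (\<forall>U x. open U \<and> x \<in> U \<longrightarrow> (\<exists>n. {y. agree h n x y} \<subseteq> U))"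

lemma agree_refl [simp]: "agree h n x x"
  by (simp add: agree_def)

lemma agree_sym: "agree h n x y \<longleftrightarrow> agree h n y x"
  by (auto simp: agree_def)

lemma agree_trans: "agree h n x y \<Longrightarrow> agree h n y z \<Longrightarrow> agree h n x z"
  by (simp add: agree_def)

lemma agree_mono: "agree h n x y \<Longrightarrow> m \<le> n \<Longrightarrow> agree h m x y"
  by (simp add: agree_def)

lemma open_agree:
  assumes "cylinder_base h"
  shows "open {y. agree h n x y}"
proof -
  have "open {g :: nat \<Rightarrow> nat. \<forall>i\<in>{..<n}. g i \<in> {h x i}}"
    by (rule product_topology_basis') (auto simp: open_discrete)
  then have "open (h -` {g. \<forall>i\<in>{..<n}. g i \<in> {h x i}})"
    using assms by (intro open_vimage) (auto simp: cylinder_base_def)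
  moreover have "h -` {g. \<forall>i\<in>{..<n}. g i \<in> {h x i}} = {y. agree h n x y}"
    by (auto simp: agree_def)
  ultimately show ?thesis by simp
qed

lemma continuous_on_cylinder:
  assumes "cylinder_base h"
  shows "continuous_on X f \<longleftrightarrow>
    (\<forall>x\<in>X. \<forall>V. open V \<longrightarrow> f x \<in> V \<longrightarrow> (\<exists>n. \<forall>y\<in>X. agree h n x y \<longrightarrow> f y \<in> V))"
    (is "?l \<longleftrightarrow> ?r")
proof
  assume l: ?l
  show ?r
  proof (intro ballI allI impI)
    fix x V assume "x \<in> X" "open V" "f x \<in> V"
    then obtain A where A: "open A" "x \<in> A" "\<forall>y\<in>X. y \<in> A \<longrightarrow> f y \<in> V"
      using l unfolding continuous_on_topological by blast
    then obtain n where "{y. agree h n x y} \<subseteq> A"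
      using assms unfolding cylinder_base_def by blast
    then show "\<exists>n. \<forall>y\<in>X. agree h n x y \<longrightarrow> f y \<in> V"
      using A by blast
  qed
next
  assume r: ?r
  show ?l
    unfolding continuous_on_topological
  proof (intro ballI allI impI)
    fix x V assume "x \<in> X" "open V" "f x \<in> V"
    then obtain n where "\<forall>y\<in>X. agree h n x y \<longrightarrow> f y \<in> V"
      using r by blast
    then show "\<exists>A. open A \<and> x \<in> A \<and> (\<forall>y\<in>X. y \<in> A \<longrightarrow> f y \<in> V)"
      using open_agree[OF assms, of n x] by (intro exI[of _ "{y. agree h n x y}"]) auto
  qed
qed

lemma continuous_on_cylinder_real:
  fixes f :: "'a::topological_space \<Rightarrow> real"
  assumes "cylinder_base h"
  shows "continuous_on X f \<longleftrightarrow>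
    (\<forall>x\<in>X. \<forall>e>0. \<exists>n. \<forall>y\<in>X. agree h n x y \<longrightarrow> \<bar>f y - f x\<bar> < e)" (is "?l \<longleftrightarrow> ?r")
proof
  assume l: ?l
  show ?r
  proof (intro ballI allI impI)
    fix x and e :: real assume "x \<in> X" "0 < e"
    then have "\<exists>n. \<forall>y\<in>X. agree h n x y \<longrightarrow> f y \<in> ball (f x) e"
      by (intro l[unfolded continuous_on_cylinder[OF assms], rule_format]) auto
    then show "\<exists>n. \<forall>y\<in>X. agree h n x y \<longrightarrow> \<bar>f y - f x\<bar> < e"
      by (simp add: dist_real_def abs_minus_commute)
  qed
next
  assume r: ?r
  show ?l
    unfolding continuous_on_cylinder[OF assms]
  proof (intro ballI allI impI)
    fix x V assume "x \<in> X" "open V" "f x \<in> V"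
    then obtain e where e: "e > 0" "ball (f x) e \<subseteq> V"
      using open_contains_ball by blast
    then obtain n where "\<forall>y\<in>X. agree h n x y \<longrightarrow> \<bar>f y - f x\<bar> < e"
      using r \<open>x \<in> X\<close> by blast
    then show "\<exists>n. \<forall>y\<in>X. agree h n x y \<longrightarrow> f y \<in> V"
      using e(2) by (intro exI[of _ n]) (auto simp: dist_real_def abs_minus_commute subset_iff)
  qed
qed

section \<open>Codings of sequences, countable families and pairs\<close>

lemma open_fun_contains_box:
  fixes x :: "'i \<Rightarrow> 'b::topological_space"
  assumes "open U" "x \<in> U"
  obtains Y where "\<forall>i. x i \<in> Y i" "\<forall>i. open (Y i)" "finite {i. Y i \<noteq> UNIV}"
    "\<forall>y. (\<forall>i. y i \<in> Y i) \<longrightarrow> y \<in> U"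
proof -
  have "openin (product_topology (\<lambda>_. euclidean) UNIV) U"
    using assms(1) by (simp add: open_fun_def)
  from product_topology_open_contains_basis[OF this assms(2)]
  obtain Y where Y: "x \<in> Pi\<^sub>E UNIV Y" "\<forall>i. openin euclidean (Y i)"
    "finite {i. Y i \<noteq> topspace euclidean}" "Pi\<^sub>E UNIV Y \<subseteq> U"
    by blast
  show thesis
  proof (rule that[of Y])
    show "\<forall>y. (\<forall>i. y i \<in> Y i) \<longrightarrow> y \<in> U"
      using Y(4) by (auto simp: PiE_def)
  qed (use Y in auto)
qed

lemma cylinder_base_id: "cylinder_base (\<lambda>w. w)"
proof -
  have "\<exists>n. {y. agree (\<lambda>w. w) n x y} \<subseteq> U" if ou: "open U" and xu: "x \<in> U" for U and x :: "nat \<Rightarrow> nat"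
  proof -
    obtain Y where Y: "\<forall>i. x i \<in> Y i" "\<forall>i. open (Y i)" "finite {i. Y i \<noteq> UNIV}"
      "\<forall>y. (\<forall>i. y i \<in> Y i) \<longrightarrow> y \<in> U"
      by (rule open_fun_contains_box[OF ou xu])
    obtain n where n: "\<And>i. Y i \<noteq> UNIV \<Longrightarrow> i < n"
      using Y(3) unfolding finite_nat_set_iff_bounded by blast
    have "y \<in> U" if y: "agree (\<lambda>w. w) n x y" for y
    proof (rule Y(4)[rule_format])
      fix i show "y i \<in> Y i"
      proof (cases "Y i = UNIV")
        case False
        then show ?thesis using y n[OF False] Y(1) by (metis agree_def)
      qed simp
    qed
    then show ?thesis by blast
  qed
  then show ?thesis by (auto simp: cylinder_base_def continuous_on_id)
qed

text \<open>Position \<open>prod_encode (to_nat i, j)\<close> carries entry \<open>j\<close> of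
  component \<open>i\<close>, so a finite part of a countable family of sequences is seen in a
  finite prefix of one sequence.\<close>

definition fun_code :: "('i::countable \<Rightarrow> nat \<Rightarrow> nat) \<Rightarrow> nat \<Rightarrow> nat" where
  "fun_code f k = (case prod_decode k of (i, j) \<Rightarrow> f (from_nat i) j)"

lemma cylinder_base_fun: "cylinder_base (fun_code :: ('i::countable \<Rightarrow> nat \<Rightarrow> nat) \<Rightarrow> _)"
proof -
  have "continuous_on UNIV (\<lambda>f :: 'i \<Rightarrow> nat \<Rightarrow> nat. f i j)" for i j
    by (rule continuous_on_product_then_coordinatewise[OF continuous_on_product_coordinates])
  then have 1: "continuous_on UNIV (fun_code :: ('i \<Rightarrow> nat \<Rightarrow> nat) \<Rightarrow> _)"
    by (intro continuous_on_coordinatewise_then_product) (simp add: fun_code_def case_prod_beta)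
  have 2: "\<exists>n. {y. agree fun_code n x y} \<subseteq> U" if ou: "open U" and xu: "x \<in> U" for U and x :: "'i \<Rightarrow> nat \<Rightarrow> nat"
  proof -
    obtain Y where Y: "\<forall>i. x i \<in> Y i" "\<forall>i. open (Y i)" "finite {i. Y i \<noteq> UNIV}"
      "\<forall>y. (\<forall>i. y i \<in> Y i) \<longrightarrow> y \<in> U"
      by (rule open_fun_contains_box[OF ou xu])
    have "\<exists>n. {y. agree (\<lambda>w. w) n (x i) y} \<subseteq> Y i" for i
      using Y(1,2) cylinder_base_id unfolding cylinder_base_def by blast
    then obtain N where N: "\<And>i. {y. agree (\<lambda>w. w) (N i) (x i) y} \<subseteq> Y i"
      by metis
    \<comment> \<open>The finitely many positions that decide membership in the box: only the
      constrained components are read, each up to its own length \<open>N i\<close>.\<close>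
    let ?S = "\<Union>i\<in>{i. Y i \<noteq> UNIV}. (\<lambda>j. prod_encode (to_nat i, j)) ` {..<N i}"
    have "finite ?S" using Y(3) by blast
    then obtain n where n: "\<forall>k\<in>?S. k < n"
      unfolding finite_nat_set_iff_bounded by blast
    have "y i \<in> Y i" if y: "agree fun_code n x y" for y i
    proof (cases "Y i = UNIV")
      case False
      have "x i j = y i j" if "j < N i" for j
      proof -
        have "prod_encode (to_nat i, j) < n"
          using n False that by blast
        then have "fun_code x (prod_encode (to_nat i, j)) = fun_code y (prod_encode (to_nat i, j))"
          using y unfolding agree_def by blast
        then show ?thesis by (simp add: fun_code_def)
      qed
      then show ?thesis
        using N[of i] by (auto simp: agree_def)
    qed auto
    then show ?thesis using Y(4) by (intro exI[of _ n]) blast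
  qed
  show ?thesis
    using 1 2 by (auto simp: cylinder_base_def)
qed

definition pair_code :: "('a \<Rightarrow> nat \<Rightarrow> nat) \<Rightarrow> ('b \<Rightarrow> nat \<Rightarrow> nat) \<Rightarrow> 'a \<times> 'b \<Rightarrow> nat \<Rightarrow> nat" where
  "pair_code h k p i = (if even i then h (fst p) (i div 2) else k (snd p) (i div 2))"

lemma cylinder_base_pair:
  assumes h: "cylinder_base h" and k: "cylinder_base k"
  shows "cylinder_base (pair_code h k)"
proof -
  have hk: "continuous_on UNIV (\<lambda>x. h x i)" "continuous_on UNIV (\<lambda>y. k y i)" for i
    using h k by (auto simp: cylinder_base_def intro: continuous_on_product_then_coordinatewise)
  have "continuous_on UNIV (\<lambda>p. h (fst p) i)" "continuous_on UNIV (\<lambda>p. k (snd p) i)" for i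
    by (rule continuous_on_compose2[OF hk(1)] continuous_on_compose2[OF hk(2)];
        auto intro: continuous_intros)+
  then have "continuous_on UNIV (\<lambda>p. pair_code h k p i)" for i
    by (cases "even i") (simp_all add: pair_code_def)
  then have 1: "continuous_on UNIV (pair_code h k)"
    by (rule continuous_on_coordinatewise_then_product)
  have 2: "\<exists>n. {q. agree (pair_code h k) n p q} \<subseteq> U" if op: "open U" and pU: "p \<in> U" for U p
  proof -
    obtain A B where AB: "open A" "open B" "fst p \<in> A" "snd p \<in> B" "A \<times> B \<subseteq> U"
      using open_prod_elim[OF op pU] by (metis mem_Times_iff)
    obtain a b where a: "{y. agree h a (fst p) y} \<subseteq> A" and b: "{y. agree k b (snd p) y} \<subseteq> B"
      using h k AB unfolding cylinder_base_def by metis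
    \<comment> \<open>The codes are interleaved, so a prefix of this length covers the first
      \<open>a\<close> entries on even positions and the first \<open>b\<close> on odd ones.\<close>
    have "q \<in> U" if q: "agree (pair_code h k) (2 * (a + b) + 1) p q" for q
    proof -
      have "h (fst p) i = h (fst q) i" if "i < a" for i
        using q[unfolded agree_def, rule_format, of "2 * i"] that by (simp add: pair_code_def)
      moreover have "k (snd p) i = k (snd q) i" if "i < b" for i
        using q[unfolded agree_def, rule_format, of "2 * i + 1"] that by (simp add: pair_code_def)
      ultimately have "fst q \<in> A" "snd q \<in> B"
        using a b by (auto simp: agree_def subset_iff)
      then show ?thesis using AB(5) by (metis SigmaI prod.collapse subsetD)
    qed
    then show ?thesis by blast
  qed
  show ?thesis using 1 2 by (auto simp: cylinder_base_def)
qed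

text \<open>The least code of a pair \<open>(n, k)\<close> for which the \<open>n\<close>-cylinder
  around \<open>x\<close> stays in \<open>O' k\<close> is locally constant: deciding all codes up to
  the least one involves only short cylinders.\<close>

lemma continuous_selection_nat:
  assumes h: "cylinder_base h"
    and cov: "\<And>x. x \<in> X \<Longrightarrow> \<exists>k n. \<forall>y\<in>X. agree h n x y \<longrightarrow> y \<in> O' k"
  obtains \<kappa> :: "'a::topological_space \<Rightarrow> nat"
  where "continuous_on X \<kappa>" "\<forall>x\<in>X. x \<in> O' (\<kappa> x)"
proof -
  define Q where "Q x p \<longleftrightarrow> (case prod_decode p of (n, k) \<Rightarrow> \<forall>y\<in>X. agree h n x y \<longrightarrow> y \<in> O' k)"
    for x p
  define L where "L x = (LEAST p. Q x p)" for x
  have ex: "\<exists>p. Q x p" if x: "x \<in> X" for x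
  proof -
    obtain k n where "\<forall>y\<in>X. agree h n x y \<longrightarrow> y \<in> O' k"
      using cov[OF x] by blast
    then show ?thesis
      by (intro exI[of _ "prod_encode (n, k)"]) (simp add: Q_def)
  qed
  have QL: "Q x (L x)" if "x \<in> X" for x
    unfolding L_def using ex[OF that] by (rule LeastI_ex)
  have in_O: "x \<in> O' (snd (prod_decode (L x)))" if "x \<in> X" for x
    using QL[OF that] that by (auto simp: Q_def case_prod_beta)
  have const: "L y = L x" if x: "x \<in> X" and ag: "agree h (L x + 1) x y" for x y
  proof -
    have "Q y p \<longleftrightarrow> Q x p" if "p \<le> L x" for p
    proof -
      obtain n k where nk: "prod_decode p = (n, k)" by (cases "prod_decode p")
      \<comment> \<open>\<open>prod_encode\<close> dominates its first component, so agreement up to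
        \<open>L x + 1\<close> settles every test with code at most \<open>L x\<close>.\<close>
      then have "n \<le> p"
        by (metis le_prod_encode_1 prod_decode_inverse)
      then have "agree h n x y"
        using ag that by (elim agree_mono) auto
      then have "agree h n x z \<longleftrightarrow> agree h n y z" for z
        by (meson agree_sym agree_trans)
      then show ?thesis by (simp add: Q_def nk)
    qed
    then show ?thesis
      using QL[OF x] by (metis L_def Least_le LeastI le_antisym nle_le)
  qed
  have "continuous_on X (\<lambda>x. snd (prod_decode (L x)))"
    unfolding continuous_on_cylinder[OF h] using const by metis
  then show thesis using that in_O by blast
qed

text \<open>Off a relatively closed set \<open>S\<close> every point has a largest cylinder meeting \<open>S\<close>.
  Functions of that cylinder are locally constant, and they behave well at \<open>S\<close> because the
  cylinders shrink.\<close>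

definition exit_index :: "('a \<Rightarrow> nat \<Rightarrow> nat) \<Rightarrow> 'a set \<Rightarrow> 'a \<Rightarrow> nat" where
  "exit_index h S x = (LEAST n. \<forall>y\<in>S. \<not> agree h n x y)"

text \<open>Cylinders around \<open>x\<close> decrease, so those missing \<open>S\<close> are
  exactly those of length at least the exit index. A point sharing that many entries passes the same
  tests and has the same index.\<close>

lemma exit_index_props:
  assumes "\<exists>n. \<forall>y\<in>S. \<not> agree h n x y"
  shows "\<forall>y\<in>S. \<not> agree h (exit_index h S x) x y"
    and "n < exit_index h S x \<Longrightarrow> \<exists>y\<in>S. agree h n x y"
    and "agree h (exit_index h S x) x z \<Longrightarrow> exit_index h S z = exit_index h S x"
proof -
  let ?e = "exit_index h S"
  show 1: "\<forall>y\<in>S. \<not> agree h (?e x) x y"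
    unfolding exit_index_def using assms by (rule LeastI_ex)
  show 2: "n < ?e x \<Longrightarrow> \<exists>y\<in>S. agree h n x y" for n
    unfolding exit_index_def using not_less_Least by blast
  assume ag: "agree h (?e x) x z"
  have "(\<forall>y\<in>S. \<not> agree h n z y) \<longleftrightarrow> ?e x \<le> n" for n
  proof (cases "?e x \<le> n")
    case True
    then show ?thesis using 1 ag by (meson agree_mono agree_trans)
  next
    case False
    then show ?thesis using 2[of n] ag
      by (meson agree_mono agree_sym agree_trans nle_le not_le_imp_less)
  qed
  then show "?e z = ?e x"
    unfolding exit_index_def[of _ _ z] by (intro Least_equality) auto
qed

text \<open>Off \<open>S\<close>, the value is copied from a point of \<open>S\<close> in the last
  cylinder that still meets \<open>S\<close>. The chosen point depends on the cylinder only, and it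
  tends to \<open>x\<close> when the argument tends to \<open>x\<close> in \<open>S\<close>.\<close>

lemma extend_from_closed:
  fixes f :: "'a::topological_space \<Rightarrow> 'i \<Rightarrow> real"
  assumes h: "cylinder_base h" and "S \<subseteq> U"
    and clo: "\<And>x. x \<in> U - S \<Longrightarrow> \<exists>n. \<forall>y\<in>S. \<not> agree h n x y"
    and f: "\<And>i. continuous_on S (\<lambda>x. f x i)"
    and rng: "\<And>x i. x \<in> S \<Longrightarrow> f x i \<in> {0..1}"
  obtains g where "\<And>i. continuous_on U (\<lambda>x. g x i)" "\<And>x. x \<in> S \<Longrightarrow> g x = f x"
    "\<And>x i. g x i \<in> {0..1}"
proof -
  let ?e = "exit_index h S"
  define pick where "pick x = (SOME y. y \<in> S \<and> agree h (?e x - 1) x y)" for x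
  \<comment> \<open>On \<open>U - S\<close> the exit index is 0 only if \<open>S\<close> is empty,
    since cylinders of length 0 are everything. Then there is nothing to pick, and the default 0
    respects the range.\<close>
  define g where "g x = (if x \<in> S then f x else if x \<in> U \<and> 0 < ?e x then f (pick x) else (\<lambda>_. 0))" for x
  have pick: "pick x \<in> S" "agree h (?e x - 1) x (pick x)" if "x \<in> U - S" "0 < ?e x" for x
  proof -
    have "\<exists>y. y \<in> S \<and> agree h (?e x - 1) x y"
      using exit_index_props(2)[OF clo[OF that(1)], of "?e x - 1"] that by auto
    then show "pick x \<in> S" "agree h (?e x - 1) x (pick x)"
      unfolding pick_def by (metis (mono_tags, lifting) someI_ex)+
  qed
  have "continuous_on U (\<lambda>x. g x i)" for i
    unfolding continuous_on_cylinder_real[OF h]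
  proof (intro ballI allI impI)
    fix x and \<epsilon> :: real assume x: "x \<in> U" and \<epsilon>: "0 < \<epsilon>"
    show "\<exists>n. \<forall>y\<in>U. agree h n x y \<longrightarrow> \<bar>g y i - g x i\<bar> < \<epsilon>"
    proof (cases "x \<in> S")
      case True
      obtain n where n: "\<And>y. y \<in> S \<Longrightarrow> agree h n x y \<Longrightarrow> \<bar>f y i - f x i\<bar> < \<epsilon>"
        using f[of i] True \<epsilon> unfolding continuous_on_cylinder_real[OF h] by blast
      have "\<bar>g y i - g x i\<bar> < \<epsilon>" if y: "y \<in> U" "agree h (n + 1) x y" for y
      proof (cases "y \<in> S")
        case True
        moreover have "agree h n x y" using y(2) by (rule agree_mono) simp
        ultimately show ?thesis using n[of y] \<open>x \<in> S\<close> by (simp add: g_def)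
      next
        case False
        \<comment> \<open>The point \<open>x\<close> of \<open>S\<close> lies in the cylinder of
          length \<open>n + 1\<close> around \<open>y\<close>, so \<open>y\<close> exits later than
          that and \<open>pick y\<close> is also close to \<open>x\<close>.\<close>
        then have "\<not> agree h (?e y) y x"
          using exit_index_props(1)[OF clo] y True by auto
        then have "?e y > n + 1"
          using y(2) by (metis agree_mono agree_sym leI)
        then have "agree h n y (pick y)" and S: "pick y \<in> S" "0 < ?e y"
          using pick[of y] False y(1) by (auto elim: agree_mono)
        then have "agree h n x (pick y)"
          using y(2) by (meson agree_mono agree_trans le_add1)
        then show ?thesis
          using n[of "pick y"] S True False y(1) by (auto simp: g_def)
      qed
      then show ?thesis by blast
    next
      case False
      have "g y i = g x i" if y: "y \<in> U" "agree h (?e x) x y" for y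
      proof -
        have xUS: "x \<in> U - S" using False x by simp
        have e: "?e y = ?e x"
          using exit_index_props(3)[OF clo[OF xUS] y(2)] .
        have "y \<notin> S"
          using exit_index_props(1)[OF clo[OF xUS]] y(2) by blast
        \<comment> \<open>\<open>SOME\<close> is thus applied to the same predicate at
          \<open>x\<close> and at \<open>y\<close>.\<close>
        have "agree h (?e x - 1) x z \<longleftrightarrow> agree h (?e x - 1) y z" for z
          using y(2) by (meson agree_mono agree_sym agree_trans diff_le_self)
        then have "pick y = pick x" by (simp add: pick_def e)
        then show ?thesis using e \<open>y \<notin> S\<close> False x y by (simp add: g_def)
      qed
      then show ?thesis using \<epsilon> by (intro exI[of _ "?e x"]) auto
    qed
  qed
  moreover have "g x i \<in> {0..1}" for x i
    using rng pick[of x] by (auto simp: g_def)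
  ultimately show thesis using that[of g] by (simp add: g_def)
qed

text \<open>Off \<open>S\<close>, the supremum of \<open>E\<close> over the whole exit cylinder is
  locally constant and dominates \<open>E\<close>. Near \<open>S\<close> the exit cylinders are
  short-ranged enough for \<open>small\<close> to bound this supremum.\<close>

lemma continuous_majorant:
  fixes E :: "'a::topological_space \<Rightarrow> real set"
  assumes h: "cylinder_base h" and "S \<subseteq> U"
    and clo: "\<And>x. x \<in> U - S \<Longrightarrow> \<exists>n. \<forall>y\<in>S. \<not> agree h n x y"
    and rng: "\<And>x. x \<in> U \<Longrightarrow> E x \<subseteq> {0..1}"
    and small: "\<And>x \<epsilon>. x \<in> S \<Longrightarrow> 0 < \<epsilon> \<Longrightarrow> \<exists>n. \<forall>y\<in>U. agree h n x y \<longrightarrow> (\<forall>t\<in>E y. t < \<epsilon>)"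
  obtains g where "continuous_on U g" "\<And>x. x \<in> S \<Longrightarrow> g x = 0" "\<And>x. g x \<in> {0..1}"
    "\<And>x t. x \<in> U \<Longrightarrow> t \<in> E x \<Longrightarrow> t \<le> g x"
proof -
  let ?e = "exit_index h S"
  \<comment> \<open>The inserted 0 makes the set nonempty and its supremum nonnegative.\<close>
  define B where "B x = insert 0 (\<Union>y\<in>{y\<in>U. agree h (?e x) x y}. E y)" for x
  define g where "g x = (if x \<in> S then 0 else Sup (B x))" for x
  have B: "B x \<subseteq> {0..1}" for x
    using rng by (auto simp: B_def)
  then have bdd: "bdd_above (B x)" for x
    by (meson bdd_above_Icc bdd_above_mono)
  have g01: "g x \<in> {0..1}" for x
  proof -
    have "0 \<le> Sup (B x)" by (rule cSup_upper) (use bdd in \<open>auto simp: B_def\<close>)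
    moreover have "Sup (B x) \<le> 1" by (rule cSup_least) (use B[of x] in \<open>auto simp: B_def subset_iff\<close>)
    ultimately show ?thesis by (simp add: g_def)
  qed
  have "continuous_on U g"
    unfolding continuous_on_cylinder_real[OF h]
  proof (intro ballI allI impI)
    fix x and \<epsilon> :: real assume x: "x \<in> U" and \<epsilon>: "0 < \<epsilon>"
    show "\<exists>n. \<forall>y\<in>U. agree h n x y \<longrightarrow> \<bar>g y - g x\<bar> < \<epsilon>"
    proof (cases "x \<in> S")
      case True
      obtain n where n: "\<And>y t. y \<in> U \<Longrightarrow> agree h n x y \<Longrightarrow> t \<in> E y \<Longrightarrow> t < \<epsilon> / 2"
        using small[OF True, of "\<epsilon> / 2"] \<epsilon> by auto
      have "\<bar>g y - g x\<bar> < \<epsilon>" if y: "y \<in> U" "agree h n x y" for y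
      proof (cases "y \<in> S")
        case False
        then have "\<not> agree h (?e y) y x"
          using exit_index_props(1)[OF clo] y True by auto
        then have e: "?e y > n"
          using y(2) by (metis agree_mono agree_sym leI)
        have "t \<le> \<epsilon> / 2" if t: "t \<in> B y" for t
        proof (cases "t = 0")
          case False
          then obtain z where z: "z \<in> U" "agree h (?e y) y z" "t \<in> E z"
            using t by (auto simp: B_def)
          then have "agree h n x z"
            using y(2) e by (meson agree_mono agree_trans less_imp_le)
          then show ?thesis using n[OF z(1) _ z(3)] by simp
        qed (use \<epsilon> in auto)
        then have "Sup (B y) \<le> \<epsilon> / 2" by (intro cSup_least) (auto simp: B_def)
        then show ?thesis using g01[of y] False True \<epsilon> by (auto simp: g_def)
      qed (use True \<epsilon> in \<open>auto simp: g_def\<close>)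
      then show ?thesis by blast
    next
      case False
      have "g y = g x" if y: "y \<in> U" "agree h (?e x) x y" for y
      proof -
        have xUS: "x \<in> U - S" using False x by simp
        have e: "?e y = ?e x"
          using exit_index_props(3)[OF clo[OF xUS] y(2)] .
        have "y \<notin> S"
          using exit_index_props(1)[OF clo[OF xUS]] y(2) by blast
        have "agree h (?e x) x z \<longleftrightarrow> agree h (?e x) y z" for z
          using y(2) by (meson agree_sym agree_trans)
        then have "B y = B x" by (simp add: B_def e)
        then show ?thesis using \<open>y \<notin> S\<close> False by (simp add: g_def)
      qed
      then show ?thesis using \<epsilon> by (intro exI[of _ "?e x"]) auto
    qed
  qed
  moreover have "g x = 0" if "x \<in> S" for x
    using that by (simp add: g_def)
  moreover have "t \<le> g x" if x: "x \<in> U" and t: "t \<in> E x" for x t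
  proof (cases "x \<in> S")
    case True
    show ?thesis
    proof (rule ccontr)
      assume "\<not> t \<le> g x"
      then have "0 < t" using True by (simp add: g_def)
      then obtain n where "\<forall>y\<in>U. agree h n x y \<longrightarrow> (\<forall>s\<in>E y. s < t)"
        using small[OF True] by blast
      then show False using x t by (metis agree_refl less_irrefl)
    qed
  next
    case False
    then show ?thesis
      using x t bdd by (auto simp: g_def B_def intro!: cSup_upper)
  qed
  ultimately show thesis using that g01 by blast
qed


section \<open>Basic points of polytopes\<close>

text \<open>Only the coordinates below the current dimension count. Elimination can therefore lower
  the dimension without changing the type of points.\<close>

type_synonym point = "nat \<Rightarrow> real"

definition dotp :: "nat \<Rightarrow> point \<Rightarrow> point \<Rightarrow> real" where
  "dotp m a x = (\<Sum>j<m. a j * x j)"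

definition polytope_of :: "nat \<Rightarrow> (point \<times> real) set \<Rightarrow> point set" where
  "polytope_of m R = {x. \<forall>(a, b)\<in>R. dotp m a x \<le> b}"

definition tight :: "nat \<Rightarrow> (point \<times> real) set \<Rightarrow> point \<Rightarrow> (point \<times> real) set" where
  "tight m R x = {(a, b)\<in>R. dotp m a x = b}"

text \<open>The rows in \<open>R\<close> that are tight at \<open>x\<close> determine \<open>x\<close>; feasibility is not included.\<close>

definition basic_point :: "nat \<Rightarrow> (point \<times> real) set \<Rightarrow> point \<Rightarrow> bool" where
  "basic_point m R x \<longleftrightarrow> (\<forall>h. (\<forall>(a, b)\<in>tight m R x. dotp m a h = 0) \<longrightarrow> (\<forall>j<m. h j = 0))"

lemma dotp_add_scale: "dotp m a (\<lambda>j. x j + t * h j) = dotp m a x + t * dotp m a h"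
  by (simp add: dotp_def algebra_simps sum.distrib sum_distrib_left)

text \<open>This is the ratio test of the simplex method: rows tight at \<open>x\<close> stay tight
  along \<open>h\<close>, boundedness forces some other row to block the ray, and the first blocking
  row becomes tight.\<close>

lemma move_to_tight:
  assumes "finite R" and bnd: "\<And>x j. x \<in> polytope_of m R \<Longrightarrow> j < m \<Longrightarrow> x j \<in> {0..1}"
    and x: "x \<in> polytope_of m R"
    and h: "\<forall>(a, b)\<in>tight m R x. dotp m a h = 0" and j: "j < m" "h j \<noteq> 0"
  obtains t where "0 < t" "(\<lambda>j. x j + t * h j) \<in> polytope_of m R"
    "tight m R x \<subset> tight m R (\<lambda>j. x j + t * h j)"
proof -
  \<comment> \<open>The rows that can block the direction \<open>h\<close>; \<open>q\<close> gives
    the step length at which such a row becomes tight.\<close>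
  define Rp where "Rp = {(a, b)\<in>R. 0 < dotp m a h}"
  define q where "q = (\<lambda>(a, b). (b - dotp m a x) / dotp m a h)"
  have slack: "dotp m a x < b" if "(a, b) \<in> Rp" for a b
  proof -
    have ab: "(a, b) \<in> R" "dotp m a h > 0" using that by (auto simp: Rp_def)
    then have "dotp m a x \<le> b" using x by (auto simp: polytope_of_def)
    moreover have "dotp m a x \<noteq> b"
    proof
      assume "dotp m a x = b"
      then have "(a, b) \<in> tight m R x" using ab by (simp add: tight_def)
      then show False using h ab(2) by auto
    qed
    ultimately show ?thesis by simp
  qed
  have "Rp \<noteq> {}"
  proof
    assume "Rp = {}"
    then have neg: "\<And>a b. (a, b) \<in> R \<Longrightarrow> dotp m a h \<le> 0"
      by (force simp: Rp_def)
    have "(\<lambda>j. x j + s * h j) \<in> polytope_of m R" if "0 \<le> s" for s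
    proof -
      have "dotp m a x + s * dotp m a h \<le> b" if "(a, b) \<in> R" for a b
      proof -
        have "dotp m a x \<le> b" using x that by (auto simp: polytope_of_def)
        then show ?thesis using mult_nonneg_nonpos[OF \<open>0 \<le> s\<close> neg[OF that]] by linarith
      qed
      then show ?thesis by (auto simp: polytope_of_def dotp_add_scale)
    qed
    \<comment> \<open>At this parameter coordinate \<open>j\<close> has moved by 2, which the unit
      interval does not allow.\<close>
    from bnd[OF this[of "2 / \<bar>h j\<bar>"] j(1)] bnd[OF x j(1)] j(2)
    show False by (cases "h j < 0") auto
  qed
  have fin: "finite Rp" by (rule finite_subset[OF _ \<open>finite R\<close>]) (auto simp: Rp_def)
  define t where "t = Min (q ` Rp)"
  have "t \<in> q ` Rp" unfolding t_def using fin \<open>Rp \<noteq> {}\<close> by simp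
  then obtain a0 b0 where r0: "(a0, b0) \<in> Rp" "t = q (a0, b0)" by auto
  have t: "0 < t" using slack[OF r0(1)] r0 by (auto simp: q_def Rp_def)
  have "dotp m a x + t * dotp m a h \<le> b" if ab: "(a, b) \<in> R" for a b
  proof (cases "0 < dotp m a h")
    case True
    then have "t \<le> q (a, b)"
      unfolding t_def using fin ab by (intro Min_le) (auto simp: Rp_def)
    then show ?thesis using True by (simp add: q_def field_simps)
  next
    case False
    then have "t * dotp m a h \<le> 0" using t by (simp add: mult_nonneg_nonpos)
    then show ?thesis using x ab by (force simp: polytope_of_def)
  qed
  then have 1: "(\<lambda>j. x j + t * h j) \<in> polytope_of m R"
    by (auto simp: polytope_of_def dotp_add_scale)
  have "tight m R x \<subseteq> tight m R (\<lambda>j. x j + t * h j)"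
    using h by (fastforce simp: tight_def dotp_add_scale)
  moreover have "(a0, b0) \<in> tight m R (\<lambda>j. x j + t * h j)"
  proof -
    have "(a0, b0) \<in> R" "t * dotp m a0 h = b0 - dotp m a0 x"
      using r0 by (auto simp: q_def Rp_def)
    then show ?thesis by (simp add: tight_def dotp_add_scale)
  qed
  moreover have "(a0, b0) \<notin> tight m R x"
    using slack[OF r0(1)] by (auto simp: tight_def)
  ultimately show thesis using that[OF t 1] by blast
qed

text \<open>A point that is not basic lies between two points of the polytope with more tight rows,
  reached along \<open>h\<close> and \<open>- h\<close>; induct on the number of slack rows. The
  form with a set \<open>H\<close> gives convex generation by basic points and, with
  \<open>H = {}\<close>, their existence.\<close>

lemma polytope_basic_induct:
  assumes "finite R" and bnd: "\<And>x j. x \<in> polytope_of m R \<Longrightarrow> j < m \<Longrightarrow> x j \<in> {0..1}"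
    and basic: "\<And>x. x \<in> polytope_of m R \<Longrightarrow> basic_point m R x \<Longrightarrow> x \<in> H"
    and conv: "\<And>x y u. x \<in> H \<Longrightarrow> y \<in> H \<Longrightarrow> 0 \<le> u \<Longrightarrow> u \<le> 1 \<Longrightarrow> (\<lambda>j. (1 - u) * x j + u * y j) \<in> H"
    and x: "x \<in> polytope_of m R"
  shows "x \<in> H"
  using x
proof (induction "card (R - tight m R x)" arbitrary: x rule: less_induct)
  case less
  show ?case
  proof (cases "basic_point m R x")
    case True
    then show ?thesis using basic less.prems by blast
  next
    case False
    then obtain h j where h: "\<forall>(a, b)\<in>tight m R x. dotp m a h = 0" and j: "j < m" "h j \<noteq> 0"
      unfolding basic_point_def by blast
    obtain s where s: "0 < s" "(\<lambda>j. x j + s * h j) \<in> polytope_of m R"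
      "tight m R x \<subset> tight m R (\<lambda>j. x j + s * h j)"
      using move_to_tight[of R m x h j] assms(1) bnd less.prems h j by blast
    have h': "\<forall>(a, b)\<in>tight m R x. dotp m a (\<lambda>j. - h j) = 0"
      using h by (auto simp: dotp_def sum_negf)
    obtain t where t: "0 < t" "(\<lambda>j. x j + t * - h j) \<in> polytope_of m R"
      "tight m R x \<subset> tight m R (\<lambda>j. x j + t * - h j)"
      using move_to_tight[of R m x "\<lambda>j. - h j" j] assms(1) bnd less.prems h' j by auto
    have smaller: "card (R - tight m R y) < card (R - tight m R x)"
      if "tight m R x \<subset> tight m R y" for y
    proof (rule psubset_card_mono)
      have "tight m R y \<subseteq> R" by (auto simp: tight_def)
      then show "R - tight m R y \<subset> R - tight m R x" using that by blast
    qed (use \<open>finite R\<close> in simp)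
    have "(\<lambda>j. x j + s * h j) \<in> H" "(\<lambda>j. x j + t * - h j) \<in> H"
      using less.hyps smaller s t by blast+
    \<comment> \<open>The weight is chosen so that the displacements \<open>s * h\<close> and
      \<open>- t * h\<close> cancel.\<close>
    then have "(\<lambda>j. (1 - s / (s + t)) * (x j + s * h j) + s / (s + t) * (x j + t * - h j)) \<in> H"
      using s(1) t(1) by (intro conv) simp_all
    moreover have "(1 - s / (s + t)) * (x j + s * h j) + s / (s + t) * (x j + t * - h j) = x j" for j
      using s(1) t(1) by (simp add: divide_simps) (simp add: algebra_simps)
    ultimately show ?thesis by simp
  qed
qed

text \<open>Eliminating the coordinate \<open>k\<close> from the hyperplanes of an arrangement. The rows of \<open>R\<close>
  are kept for the sake of those that do not involve the coordinate \<open>k\<close>; of the others only the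
  coefficients below \<open>k\<close> are used, which adds irrelevant hyperplanes. No case distinction on
  zero coefficients is made, hence everything depends polynomially on the parameter \<open>w\<close>.\<close>

type_synonym 'w prow = "('w \<Rightarrow> point) \<times> ('w \<Rightarrow> real)"

definition elim :: "nat \<Rightarrow> 'w prow set \<Rightarrow> 'w prow set" where
  "elim k R = R \<union> (\<lambda>((a, b), (a', b')).
     (\<lambda>w j. a' w k * a w j - a w k * a' w j, \<lambda>w. a' w k * b w - a w k * b' w)) ` (R \<times> R)"

text \<open>Candidates \<open>(N, D)\<close> for the basic points, in homogeneous coordinates: the point is \<open>N / D\<close>.\<close>

primrec cands :: "nat \<Rightarrow> 'w prow set \<Rightarrow> 'w prow set" where
  "cands 0 R = {(\<lambda>_ _. 0, \<lambda>_. 1)}"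
| "cands (Suc k) R = (\<lambda>((a, b), (N, D)).
     (\<lambda>w j. if j = k then b w * D w - dotp k (a w) (N w) else a w k * N w j, \<lambda>w. a w k * D w)) `
       (R \<times> cands k (elim k R))"

definition inst :: "'w prow set \<Rightarrow> 'w \<Rightarrow> (point \<times> real) set" where
  "inst R w = (\<lambda>(a, b). (a w, b w)) ` R"

lemma finite_elim: "finite R \<Longrightarrow> finite (elim k R)"
  by (simp add: elim_def)

lemma finite_cands: "finite R \<Longrightarrow> finite (cands m R)"
  by (induction m arbitrary: R) (simp_all add: finite_elim)

definition cont_prows :: "'w::topological_space set \<Rightarrow> 'w prow set \<Rightarrow> bool" where
  "cont_prows X R \<longleftrightarrow>
     (\<forall>(a, b)\<in>R. (\<forall>j. continuous_on X (\<lambda>w. a w j)) \<and> continuous_on X b)"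

lemma cont_elim: "cont_prows X R \<Longrightarrow> cont_prows X (elim k R)"
proof -
  assume "cont_prows X R"
  then have R: "continuous_on X (\<lambda>w. a w j)" "continuous_on X b" if "(a, b) \<in> R" for a b j
    using that by (auto simp: cont_prows_def)
  show ?thesis
    unfolding cont_prows_def elim_def
    by (auto intro!: continuous_on_diff continuous_on_mult dest: R)
qed

lemma cont_cands: "cont_prows X R \<Longrightarrow> cont_prows X (cands m R)"
proof (induction m arbitrary: R)
  case (Suc m)
  have R: "\<And>a b. (a, b) \<in> R \<Longrightarrow> (\<forall>j. continuous_on X (\<lambda>w. a w j)) \<and> continuous_on X b"
    using Suc.prems by (auto simp: cont_prows_def)
  have C: "\<And>a b. (a, b) \<in> cands m (elim m R) \<Longrightarrow> (\<forall>j. continuous_on X (\<lambda>w. a w j)) \<and> continuous_on X b"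
    using Suc.IH[OF cont_elim[OF Suc.prems], of m] unfolding cont_prows_def by blast
  have "(\<forall>j. continuous_on X (\<lambda>w. if j = m then b w * D w - dotp m (a w) (N w) else a w m * N w j))
      \<and> continuous_on X (\<lambda>w. a w m * D w)"
    if "(a, b) \<in> R" "(N, D) \<in> cands m (elim m R)" for a b N D
  proof -
    have [continuous_intros]: "\<And>j. continuous_on X (\<lambda>w. a w j)" "continuous_on X b"
      "\<And>j. continuous_on X (\<lambda>w. N w j)" "continuous_on X D"
      using R[OF that(1)] C[OF that(2)] by auto
    have "continuous_on X (\<lambda>w. if j = m then b w * D w - dotp m (a w) (N w) else a w m * N w j)" for j
      unfolding dotp_def by (cases "j = m") (auto intro!: continuous_intros)
    then show ?thesis by (auto intro!: continuous_intros)
  qed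
  then show ?case unfolding cont_prows_def by auto
qed (auto simp: cont_prows_def)

lemma dotp_Suc: "dotp (Suc k) a x = dotp k a x + a k * x k"
  by (simp add: dotp_def)

lemma dotp_cong: "(\<And>j. j < m \<Longrightarrow> x j = y j) \<Longrightarrow> dotp m a x = dotp m a y"
  by (simp add: dotp_def)

lemma dotp_comb: "dotp m (\<lambda>j. s * a j - t * b j) x = s * dotp m a x - t * dotp m b x"
  by (simp add: dotp_def algebra_simps sum_subtractf sum_distrib_left)

text \<open>If no tight row involved coordinate \<open>k\<close>, the \<open>k\<close>-th unit
  vector would be a nonzero solution of the tight homogeneous system. With a tight pivot row, every
  solution of the eliminated tight system extends to one of the original system.\<close>

lemma basic_point_elim:
  assumes "basic_point (Suc k) (inst R w) x"
  shows "basic_point k (inst (elim k R) w) x"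
    and "\<exists>(a, b)\<in>R. a w k \<noteq> 0 \<and> dotp (Suc k) (a w) x = b w"
proof -
  have basic: "h j = 0"
    if "\<And>a b. (a, b) \<in> R \<Longrightarrow> dotp (Suc k) (a w) x = b w \<Longrightarrow> dotp (Suc k) (a w) h = 0" "j < Suc k" for h j
  proof -
    have "\<forall>(a, b)\<in>tight (Suc k) (inst R w) x. dotp (Suc k) a h = 0"
      using that(1) by (auto simp: tight_def inst_def)
    then show ?thesis using assms that(2) unfolding basic_point_def by blast
  qed
  show "\<exists>(a, b)\<in>R. a w k \<noteq> 0 \<and> dotp (Suc k) (a w) x = b w"
  proof (rule ccontr)
    assume neg: "\<not> ?thesis"
    let ?e = "\<lambda>j. if j = k then 1 else 0 :: real"
    have "?e k = 0"
    proof (rule basic[of ?e k])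
      fix a b assume "(a, b) \<in> R" "dotp (Suc k) (a w) x = b w"
      then have "a w k = 0" using neg by auto
      then show "dotp (Suc k) (a w) ?e = 0"
        by (simp add: dotp_def)
    qed simp
    then show False by simp
  qed
  then obtain a0 b0 where r0: "(a0, b0) \<in> R" "a0 w k \<noteq> 0" "dotp (Suc k) (a0 w) x = b0 w" by auto
  show "basic_point k (inst (elim k R) w) x"
    unfolding basic_point_def
  proof (intro allI impI)
    fix h j assume h: "\<forall>(a, b)\<in>tight k (inst (elim k R) w) x. dotp k a h = 0" and j: "j < k"
    \<comment> \<open>Coordinate \<open>k\<close> is chosen so that the pivot row annihilates
      \<open>g\<close>.\<close>
    define g where "g = h(k := - dotp k (a0 w) h / a0 w k)"
    have gk: "dotp k a g = dotp k a h" for a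
      by (rule dotp_cong) (simp add: g_def)
    have "g j = 0"
    proof (rule basic[of g j])
      fix a b assume ab: "(a, b) \<in> R" "dotp (Suc k) (a w) x = b w"
      let ?a = "\<lambda>w j. a0 w k * a w j - a w k * a0 w j"
      let ?b = "\<lambda>w. a0 w k * b w - a w k * b0 w"
      have "(?a, ?b) \<in> elim k R"
        unfolding elim_def using ab(1) r0(1) by (intro UnI2 image_eqI[of _ _ "((a, b), (a0, b0))"]) auto
      then have "(?a w, ?b w) \<in> inst (elim k R) w"
        unfolding inst_def by (intro image_eqI[of _ _ "(?a, ?b)"]) auto
      moreover have "dotp k (?a w) x = ?b w"
        unfolding dotp_comb using ab(2) r0(3) by (simp add: dotp_Suc algebra_simps flip: ab(2) r0(3))
      ultimately have "dotp k (?a w) h = 0"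
        using h by (auto simp: tight_def)
      then have "a0 w k * dotp k (a w) h = a w k * dotp k (a0 w) h"
        unfolding dotp_comb by simp
      then show "dotp (Suc k) (a w) g = 0"
        using r0(2) by (simp add: dotp_Suc gk) (simp add: g_def field_simps)
    qed (use j in auto)
    then show "h j = 0" using j by (simp add: g_def)
  qed
qed

text \<open>Back substitution: the first \<open>k\<close> coordinates come from a candidate of the
  eliminated system, and the pivot row is solved for coordinate \<open>k\<close>. Scaling by the
  pivot coefficient keeps numerators and denominator polynomial.\<close>

lemma basic_point_cands:
  assumes "basic_point m (inst R w) x"
  shows "\<exists>(N, D)\<in>cands m R. D w \<noteq> 0 \<and> (\<forall>j<m. x j = N w j / D w)"
  using assms
proof (induction m arbitrary: R)
  case (Suc k)
  obtain N D where ND: "(N, D) \<in> cands k (elim k R)" "D w \<noteq> 0" "\<forall>j<k. x j = N w j / D w"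
    using Suc.IH[OF basic_point_elim(1)[OF Suc.prems]] by auto
  obtain a b where ab: "(a, b) \<in> R" "a w k \<noteq> 0" "dotp (Suc k) (a w) x = b w"
    using basic_point_elim(2)[OF Suc.prems] by auto
  let ?N = "\<lambda>w j. if j = k then b w * D w - dotp k (a w) (N w) else a w k * N w j"
  let ?D = "\<lambda>w. a w k * D w"
  have "(?N, ?D) \<in> cands (Suc k) R"
    unfolding cands.simps using ab(1) ND(1) by (intro image_eqI[of _ _ "((a, b), (N, D))"]) auto
  moreover have "?D w \<noteq> 0" using ab ND by simp
  moreover have "x j = ?N w j / ?D w" if "j < Suc k" for j
  proof (cases "j = k")
    case True
    have "dotp k (a w) x = dotp k (a w) (\<lambda>j. N w j / D w)"
      by (rule dotp_cong) (use ND in auto)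
    also have "\<dots> = dotp k (a w) (N w) / D w"
      by (simp add: dotp_def sum_divide_distrib)
    finally have "b w = dotp k (a w) (N w) / D w + a w k * x k"
      using ab(3) by (simp add: dotp_Suc)
    then have "b w * D w - dotp k (a w) (N w) = a w k * D w * x k"
      using ND(2) by (simp add: field_simps)
    then show ?thesis using True ab(2) ND(2) by (simp add: field_simps)
  next
    case False
    then show ?thesis using that ND ab(2) by simp
  qed
  ultimately show ?case by (intro bexI[of _ "(?N, ?D)"]) auto
qed auto


section \<open>Nearest points in hulls of lists\<close>

text \<open>Fixing the weights from \<open>M\<close> on to 0 keeps the set inside a compact box of
  the infinite product.\<close>

definition simplex :: "nat \<Rightarrow> point set" where
  "simplex M = {t. (\<forall>c. 0 \<le> t c) \<and> (\<forall>c\<ge>M. t c = 0) \<and> (\<Sum>c<M. t c) = 1}"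

definition comb :: "nat \<Rightarrow> point \<Rightarrow> (nat \<Rightarrow> point) \<Rightarrow> point" where
  "comb M t v = (\<lambda>j. \<Sum>c<M. t c * v c j)"

definition hull_of :: "nat \<Rightarrow> nat \<Rightarrow> (nat \<Rightarrow> point) \<Rightarrow> point set" where
  "hull_of m M v = {x. \<exists>t\<in>simplex M. \<forall>j<m. x j = comb M t v j}"

lemma compact_box: "compact {t :: nat \<Rightarrow> real. \<forall>c. t c \<in> {a..b}}"
proof -
  have "compactin (product_topology (\<lambda>_. euclidean) UNIV) (Pi\<^sub>E UNIV (\<lambda>_::nat. {a..b}))"
    by (subst compactin_PiE) (auto simp: compactin_euclidean_iff)
  then have "compact (Pi\<^sub>E UNIV (\<lambda>_::nat. {a..b}))"
    by (simp only: euclidean_product_topology compactin_euclidean_iff)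
  then show ?thesis by (simp add: PiE_def Pi_def)
qed

lemma simplex_le_1: "t \<in> simplex M \<Longrightarrow> t c \<le> 1"
  by (cases "c < M")
    (auto simp: simplex_def not_less intro!: member_le_sum[of c "{..<M}" t, THEN order_trans])

lemma continuous_coordinate: "continuous_on X (\<lambda>t. t c :: real)"
  by (rule continuous_on_subset[OF continuous_on_product_coordinates]) simp

lemma compact_simplex: "compact (simplex M)"
proof -
  have "closed {t :: point. 0 \<le> t c}" "closed {t :: point. t c = 0}" for c
    by (intro closed_Collect_le closed_Collect_eq continuous_coordinate continuous_intros)+
  then have "closed ((\<Inter>c. {t :: point. 0 \<le> t c}) \<inter> (\<Inter>c\<in>{M..}. {t. t c = 0}) \<inter> {t. (\<Sum>c<M. t c) = 1})"
    by (intro closed_Int closed_INT ballI closed_Collect_eq continuous_intros continuous_coordinate) auto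
  moreover have "simplex M = {t. \<forall>c. t c \<in> {0..1}} \<inter>
      ((\<Inter>c. {t. 0 \<le> t c}) \<inter> (\<Inter>c\<in>{M..}. {t. t c = 0}) \<inter> {t. (\<Sum>c<M. t c) = 1})"
    using simplex_le_1[of _ M] by (auto simp: simplex_def)
  ultimately show ?thesis
    by (simp only: compact_Int_closed[OF compact_box])
qed

lemma simplex_nonempty: "0 < M \<Longrightarrow> (\<lambda>c. if c = 0 then 1 else 0) \<in> simplex M"
  by (auto simp: simplex_def)

lemma simplex_segment:
  assumes "s \<in> simplex M" "t \<in> simplex M" "0 \<le> u" "u \<le> 1"
  shows "(\<lambda>c. (1 - u) * s c + u * t c) \<in> simplex M"
  using assms by (auto simp: simplex_def sum.distrib simp flip: sum_distrib_left)

lemma comb_segment: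
  "comb M (\<lambda>c. (1 - u) * s c + u * t c) v j = (1 - u) * comb M s v j + u * comb M t v j"
  by (simp add: comb_def algebra_simps sum.distrib sum_subtractf sum_distrib_left)

section \<open>Nearest points and their continuity\<close>

definition sqdist :: "nat \<Rightarrow> point \<Rightarrow> point \<Rightarrow> real" where
  "sqdist m x y = (\<Sum>j<m. (x j - y j)\<^sup>2)"

text \<open>Minimising weights need not be unique or continuous; the point they produce is both, in
  the coordinates below \<open>m\<close>.\<close>

definition nearest_weights :: "nat \<Rightarrow> nat \<Rightarrow> (nat \<Rightarrow> point) \<Rightarrow> point \<Rightarrow> point" where
  "nearest_weights m M v g =
     (SOME t. t \<in> simplex M \<and> (\<forall>s\<in>simplex M. sqdist m g (comb M t v) \<le> sqdist m g (comb M s v)))"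

definition nearest :: "nat \<Rightarrow> nat \<Rightarrow> (nat \<Rightarrow> point) \<Rightarrow> point \<Rightarrow> point" where
  "nearest m M v g = comb M (nearest_weights m M v g) v"

lemma nearest_weights:
  assumes "0 < M"
  shows "nearest_weights m M v g \<in> simplex M"
    and "s \<in> simplex M \<Longrightarrow> sqdist m g (nearest m M v g) \<le> sqdist m g (comb M s v)"
proof -
  have "continuous_on (simplex M) (\<lambda>t. sqdist m g (comb M t v))"
    unfolding sqdist_def comb_def by (intro continuous_intros continuous_coordinate)
  then have "\<exists>t. t \<in> simplex M \<and> (\<forall>s\<in>simplex M. sqdist m g (comb M t v) \<le> sqdist m g (comb M s v))"
    using continuous_attains_inf[OF compact_simplex, of M] simplex_nonempty[OF assms] by blast
  then have "nearest_weights m M v g \<in> simplex M \<and>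
      (\<forall>s\<in>simplex M. sqdist m g (comb M (nearest_weights m M v g) v) \<le> sqdist m g (comb M s v))"
    unfolding nearest_weights_def by (rule someI_ex)
  then show "nearest_weights m M v g \<in> simplex M"
    and "s \<in> simplex M \<Longrightarrow> sqdist m g (nearest m M v g) \<le> sqdist m g (comb M s v)"
    by (auto simp: nearest_def)
qed

lemma nearest_in_hull: "0 < M \<Longrightarrow> nearest m M v g \<in> hull_of m M v"
  using nearest_weights(1) by (auto simp: hull_of_def nearest_def)

lemma nearest_eq:
  assumes "g \<in> hull_of m M v" "0 < M" "j < m"
  shows "nearest m M v g j = g j"
proof -
  obtain t where t: "t \<in> simplex M" "\<forall>j<m. g j = comb M t v j"
    using assms(1) by (auto simp: hull_of_def)
  then have "sqdist m g (nearest m M v g) \<le> 0"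
    using nearest_weights(2)[OF assms(2) t(1), of m g v] by (simp add: sqdist_def)
  moreover have "(g j - nearest m M v g j)\<^sup>2 \<le> sqdist m g (nearest m M v g)"
    unfolding sqdist_def using assms(3) by (intro member_le_sum) auto
  ultimately have "(g j - nearest m M v g j)\<^sup>2 \<le> 0" by (rule order_trans[rotated])
  then show ?thesis by simp
qed

text \<open>First-order optimality: shifting the weights by a fraction \<open>u\<close> towards
  \<open>s\<close> cannot decrease the distance, and for small \<open>u\<close> the linear term
  decides.\<close>

lemma nearest_variational:
  assumes "0 < M" "s \<in> simplex M"
  shows "(\<Sum>j<m. (g j - nearest m M v g j) * (comb M s v j - nearest m M v g j)) \<le> 0"
proof -
  let ?Z = "nearest m M v g" and ?t = "nearest_weights m M v g"
  define p where "p = (\<Sum>j<m. (g j - ?Z j) * (comb M s v j - ?Z j))"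
  define E where "E = (\<Sum>j<m. (comb M s v j - ?Z j)\<^sup>2)"
  have E: "0 \<le> E" unfolding E_def by (simp add: sum_nonneg)
  have ineq: "2 * p \<le> u * E" if u: "0 < u" "u \<le> 1" for u
  proof -
    have "sqdist m g ?Z \<le> sqdist m g (comb M (\<lambda>c. (1 - u) * ?t c + u * s c) v)"
      using nearest_weights[OF assms(1)] simplex_segment assms(2) u by simp
    also have "\<dots> = (\<Sum>j<m. ((g j - ?Z j) - u * (comb M s v j - ?Z j))\<^sup>2)"
      unfolding sqdist_def comb_segment nearest_def[symmetric]
      by (intro sum.cong refl arg_cong[of _ _ "\<lambda>x. x\<^sup>2"]) (simp add: algebra_simps)
    also have "\<dots> = sqdist m g ?Z - 2 * u * p + u\<^sup>2 * E"
    proof -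
      have "((g j - ?Z j) - u * (comb M s v j - ?Z j))\<^sup>2 = (g j - ?Z j)\<^sup>2
          - 2 * u * ((g j - ?Z j) * (comb M s v j - ?Z j)) + u\<^sup>2 * (comb M s v j - ?Z j)\<^sup>2" for j
        by (simp add: power2_eq_square algebra_simps)
      then show ?thesis
        by (simp add: sqdist_def p_def E_def sum.distrib sum_subtractf flip: sum_distrib_left)
    qed
    finally have "u * (2 * p) \<le> u * (u * E)" by (simp add: power2_eq_square algebra_simps)
    then show ?thesis using u(1) by simp
  qed
  show ?thesis
  proof (rule ccontr)
    assume "\<not> ?thesis"
    then have p: "0 < p" by (simp add: p_def)
    \<comment> \<open>Small enough for \<open>u * E \<le> p\<close>, against
      \<open>2 * p \<le> u * E\<close>; adding 1 avoids a division by 0.\<close>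
    define u where "u = min 1 (p / (E + 1))"
    have "u * E \<le> p / (E + 1) * E" unfolding u_def using E by (intro mult_right_mono) auto
    also have "\<dots> \<le> p" using E p by (simp add: field_simps)
    finally show False using ineq[of u] p E by (simp add: u_def)
  qed
qed

lemma mult_le_abs_mult: "\<bar>y\<bar> \<le> d \<Longrightarrow> x * y \<le> \<bar>x\<bar> * d" for x y d :: real
proof -
  assume "\<bar>y\<bar> \<le> d"
  have "x * y \<le> \<bar>x\<bar> * \<bar>y\<bar>" by (metis abs_ge_self abs_mult)
  also have "\<dots> \<le> \<bar>x\<bar> * d" using \<open>\<bar>y\<bar> \<le> d\<close> by (simp add: mult_left_mono)
  finally show ?thesis .
qed

text \<open>The two variational inequalities are added. No matching of weights is required: each set
  of weights is transferred to the other list, which moves its combination by at most the distance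
  of the lists.\<close>

lemma nearest_diff:
  fixes m :: nat and v v' :: "nat \<Rightarrow> point" and g g' :: point
  assumes "0 < M"
  defines "Z \<equiv> nearest m M v g"
  defines "Z' \<equiv> nearest m M v' g'"
  shows "sqdist m Z' Z \<le> (\<Sum>j<m. (\<bar>g j - Z j\<bar> + \<bar>g' j - Z' j\<bar>) * (\<Sum>c<M. \<bar>v' c j - v c j\<bar>)
           + \<bar>g' j - g j\<bar> * \<bar>Z' j - Z j\<bar>)"
proof -
  let ?t = "nearest_weights m M v g" and ?t' = "nearest_weights m M v' g'"
  let ?\<delta> = "\<lambda>j. \<Sum>c<M. \<bar>v' c j - v c j\<bar>"
  have comb_diff: "\<bar>comb M t v' j - comb M t v j\<bar> \<le> ?\<delta> j" if "t \<in> simplex M" for t j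
  proof -
    have "\<bar>comb M t v' j - comb M t v j\<bar> = \<bar>\<Sum>c<M. t c * (v' c j - v c j)\<bar>"
      by (simp add: comb_def sum_subtractf algebra_simps)
    also have "\<dots> \<le> (\<Sum>c<M. \<bar>t c * (v' c j - v c j)\<bar>)" by (rule sum_abs)
    also have "\<dots> \<le> ?\<delta> j"
    proof (rule sum_mono)
      fix c show "\<bar>t c * (v' c j - v c j)\<bar> \<le> \<bar>v' c j - v c j\<bar>"
        using that simplex_le_1[OF that, of c]
        by (simp add: abs_mult simplex_def mult_left_le_one_le)
    qed
    finally show ?thesis .
  qed
  have t: "?t \<in> simplex M" and t': "?t' \<in> simplex M" using nearest_weights(1)[OF assms(1)] by auto
  \<comment> \<open>Each inequality is tested with the weights of the other problem, so its test
    point is close to the other nearest point.\<close>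
  have vi: "(\<Sum>j<m. (g j - Z j) * (comb M ?t' v j - Z j)) \<le> 0"
    and vi': "(\<Sum>j<m. (g' j - Z' j) * (comb M ?t v' j - Z' j)) \<le> 0"
    unfolding Z_def Z'_def using nearest_variational[OF assms(1)] t t' by auto
  have "sqdist m Z' Z \<le> sqdist m Z' Z
      - (\<Sum>j<m. (g j - Z j) * (comb M ?t' v j - Z j)) - (\<Sum>j<m. (g' j - Z' j) * (comb M ?t v' j - Z' j))"
    using vi vi' by simp
  also have "\<dots> = (\<Sum>j<m. (Z' j - Z j)\<^sup>2 - (g j - Z j) * (comb M ?t' v j - Z j)
      - (g' j - Z' j) * (comb M ?t v' j - Z' j))"
    by (simp add: sqdist_def sum_subtractf)
  also have "\<dots> \<le> (\<Sum>j<m. (\<bar>g j - Z j\<bar> + \<bar>g' j - Z' j\<bar>) * ?\<delta> j + \<bar>g' j - g j\<bar> * \<bar>Z' j - Z j\<bar>)"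
  proof (rule sum_mono)
    fix j
    have "(Z' j - Z j)\<^sup>2 - (g j - Z j) * (comb M ?t' v j - Z j) - (g' j - Z' j) * (comb M ?t v' j - Z' j)
      = (g j - Z j) * (Z' j - comb M ?t' v j) + (g' j - Z' j) * (Z j - comb M ?t v' j)
        + (g' j - g j) * (Z' j - Z j)"
      by (simp add: power2_eq_square algebra_simps)
    also have "\<dots> \<le> \<bar>g j - Z j\<bar> * ?\<delta> j + \<bar>g' j - Z' j\<bar> * ?\<delta> j + \<bar>g' j - g j\<bar> * \<bar>Z' j - Z j\<bar>"
    proof (intro add_mono)
      have "\<bar>Z' j - comb M ?t' v j\<bar> \<le> ?\<delta> j"
        using comb_diff[OF t'] by (simp add: Z'_def nearest_def)
      then show "(g j - Z j) * (Z' j - comb M ?t' v j) \<le> \<bar>g j - Z j\<bar> * ?\<delta> j"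
        by (rule mult_le_abs_mult)
      have "\<bar>Z j - comb M ?t v' j\<bar> \<le> ?\<delta> j"
        using comb_diff[OF t, of j] by (simp add: Z_def nearest_def abs_minus_commute)
      then show "(g' j - Z' j) * (Z j - comb M ?t v' j) \<le> \<bar>g' j - Z' j\<bar> * ?\<delta> j"
        by (rule mult_le_abs_mult)
      show "(g' j - g j) * (Z' j - Z j) \<le> \<bar>g' j - g j\<bar> * \<bar>Z' j - Z j\<bar>"
        by (metis abs_ge_self abs_mult)
    qed
    finally show "(Z' j - Z j)\<^sup>2 - (g j - Z j) * (comb M ?t' v j - Z j) - (g' j - Z' j) * (comb M ?t v' j - Z' j)
      \<le> (\<bar>g j - Z j\<bar> + \<bar>g' j - Z' j\<bar>) * ?\<delta> j + \<bar>g' j - g j\<bar> * \<bar>Z' j - Z j\<bar>"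
      unfolding distrib_right .
  qed
  finally show ?thesis .
qed

lemma nearest_bound:
  assumes "0 < M"
  shows "\<bar>nearest m M v g j\<bar> \<le> (\<Sum>c<M. \<bar>v c j\<bar>)"
proof -
  let ?t = "nearest_weights m M v g"
  have t: "?t \<in> simplex M" by (rule nearest_weights(1)[OF assms])
  have "\<bar>nearest m M v g j\<bar> \<le> (\<Sum>c<M. \<bar>?t c * v c j\<bar>)"
    unfolding nearest_def comb_def by (rule sum_abs)
  also have "\<dots> \<le> (\<Sum>c<M. \<bar>v c j\<bar>)"
  proof (rule sum_mono)
    fix c show "\<bar>?t c * v c j\<bar> \<le> \<bar>v c j\<bar>"
      using t simplex_le_1[OF t, of c] by (simp add: abs_mult simplex_def mult_left_le_one_le)
  qed
  finally show ?thesis .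
qed

text \<open>With the nearest points bounded by the list entries, \<open>nearest_diff\<close> yields
  a bound \<open>E\<close> in terms of the data alone. It tends to 0, and the error is at most its
  square root.\<close>

lemma tendsto_nearest:
  assumes M: "0 < M" and v: "\<And>c j. c < M \<Longrightarrow> j < m \<Longrightarrow> ((\<lambda>q. v q c j) \<longlongrightarrow> w c j) F"
    and g: "\<And>j. j < m \<Longrightarrow> ((\<lambda>q. g q j) \<longlongrightarrow> f j) F" and j: "j < m"
  shows "((\<lambda>q. nearest m M (v q) (g q) j) \<longlongrightarrow> nearest m M w f j) F"
proof -
  let ?Z = "\<lambda>q. nearest m M (v q) (g q)" and ?W = "nearest m M w f"
  let ?B = "\<lambda>v j. \<Sum>c<M. \<bar>v c j :: real\<bar>"
  define E where "E q = (\<Sum>j<m. (\<bar>f j\<bar> + ?B w j + (\<bar>g q j\<bar> + ?B (v q) j)) * (\<Sum>c<M. \<bar>v q c j - w c j\<bar>)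
           + \<bar>g q j - f j\<bar> * (?B (v q) j + ?B w j))" for q
  have "(E \<longlongrightarrow> (\<Sum>j<m. (\<bar>f j\<bar> + ?B w j + (\<bar>f j\<bar> + ?B w j)) * (\<Sum>c<M. \<bar>w c j - w c j\<bar>)
           + \<bar>f j - f j\<bar> * (?B w j + ?B w j))) F"
    unfolding E_def by (intro tendsto_intros v g) auto
  then have "(E \<longlongrightarrow> 0) F" by simp
  then have "((\<lambda>q. sqrt (E q)) \<longlongrightarrow> sqrt 0) F"
    by (rule tendsto_real_sqrt)
  then have lim: "((\<lambda>q. sqrt (E q)) \<longlongrightarrow> 0) F" by simp
  have "\<bar>?Z q j - ?W j\<bar> \<le> sqrt (E q)" for q
  proof (rule real_le_rsqrt)
    have "\<bar>?Z q j - ?W j\<bar>\<^sup>2 \<le> sqdist m (?Z q) ?W"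
      unfolding sqdist_def power2_abs using j by (intro member_le_sum[of j _ "\<lambda>j. (?Z q j - ?W j)\<^sup>2"]) auto
    also have "\<dots> \<le> E q"
      unfolding E_def
    proof (rule order_trans[OF nearest_diff[OF M]], intro sum_mono add_mono mult_mono)
      fix j
      have b: "\<bar>?W j\<bar> \<le> ?B w j" "\<bar>?Z q j\<bar> \<le> ?B (v q) j" by (rule nearest_bound[OF M])+
      then show "\<bar>f j - ?W j\<bar> \<le> \<bar>f j\<bar> + ?B w j" "\<bar>g q j - ?Z q j\<bar> \<le> \<bar>g q j\<bar> + ?B (v q) j"
        "\<bar>?Z q j - ?W j\<bar> \<le> ?B (v q) j + ?B w j" by linarith+
      show "0 \<le> \<bar>f j\<bar> + ?B w j + (\<bar>g q j\<bar> + ?B (v q) j)" using b by linarith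
    qed (auto intro: sum_nonneg)
    finally show "\<bar>?Z q j - ?W j\<bar>\<^sup>2 \<le> E q" .
  qed
  then have "((\<lambda>q. ?Z q j - ?W j) \<longlongrightarrow> 0) F"
    by (intro tendsto_0_le[OF lim, of _ 1]) (auto intro!: always_eventually order_trans[OF _ abs_ge_self])
  then show ?thesis
    by (simp add: LIM_zero_iff)
qed

lemma continuous_nearest:
  assumes "0 < M" "\<And>c j. c < M \<Longrightarrow> j < m \<Longrightarrow> continuous_on X (\<lambda>q. v q c j)"
    and "\<And>j. j < m \<Longrightarrow> continuous_on X (\<lambda>q. g q j)" and "j < m"
  shows "continuous_on X (\<lambda>q. nearest m M (v q) (g q) j)"
  using assms unfolding continuous_on_def by (intro ballI tendsto_nearest) auto


section \<open>Stratification\<close>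

text \<open>The extra factor \<open>D w\<close> makes the residual that of the point
  \<open>N / D\<close> times a square, so the sign of \<open>D w\<close> is irrelevant and
  feasibility is a matter of signs of functions continuous everywhere on the domain.\<close>

definition feasible_at :: "nat \<Rightarrow> 'w prow set \<Rightarrow> 'w prow \<Rightarrow> 'w \<Rightarrow> bool" where
  "feasible_at m R = (\<lambda>(N, D) w. D w \<noteq> 0 \<and> (\<forall>(a, b)\<in>R. (dotp m (a w) (N w) - b w * D w) * D w \<le> 0))"

lemma feasible_at_iff:
  "feasible_at m R (N, D) w \<longleftrightarrow> D w \<noteq> 0 \<and> (\<lambda>j. N w j / D w) \<in> polytope_of m (inst R w)"
proof (cases "D w = 0")
  case False
  have "(dotp m (a w) (N w) - b w * D w) * D w \<le> 0 \<longleftrightarrow> dotp m (a w) (\<lambda>j. N w j / D w) \<le> b w" for a b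
  proof -
    have "dotp m (a w) (\<lambda>j. N w j / D w) = dotp m (a w) (N w) / D w"
      by (simp add: dotp_def sum_divide_distrib)
    then show ?thesis
      using False by (cases "0 < D w")
        (auto simp: mult_le_0_iff pos_divide_le_eq neg_divide_le_eq not_less_iff_gr_or_eq)
  qed
  then show ?thesis using False by (auto simp: feasible_at_def polytope_of_def inst_def)
qed (simp add: feasible_at_def)

definition stratum :: "('w \<Rightarrow> real) set \<Rightarrow> 'w \<Rightarrow> nat" where
  "stratum \<F> w = card {f\<in>\<F>. f w \<noteq> 0}"

text \<open>The \<open>l\<close>-th elementary symmetric polynomial of the absolute values.\<close>

definition stratum_height :: "('w \<Rightarrow> real) set \<Rightarrow> nat \<Rightarrow> 'w \<Rightarrow> real" where
  "stratum_height \<F> l w = (\<Sum>B | B \<subseteq> \<F> \<and> card B = l. \<Prod>f\<in>B. \<bar>f w\<bar>)"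

lemma stratum_height_nonneg: "0 \<le> stratum_height \<F> l w"
  unfolding stratum_height_def by (intro sum_nonneg prod_nonneg) auto

text \<open>A sum of nonnegative products is positive iff some product is, that is, iff some
  \<open>l\<close> of the functions are all nonzero at \<open>w\<close>.\<close>

lemma stratum_height_pos_iff:
  assumes "finite \<F>"
  shows "0 < stratum_height \<F> l w \<longleftrightarrow> l \<le> stratum \<F> w"
proof
  assume "0 < stratum_height \<F> l w"
  then obtain B where B: "B \<subseteq> \<F>" "card B = l" "(\<Prod>f\<in>B. \<bar>f w\<bar>) \<noteq> 0"
    unfolding stratum_height_def by (metis (mono_tags, lifting) less_irrefl mem_Collect_eq sum.neutral)
  then have "B \<subseteq> {f\<in>\<F>. f w \<noteq> 0}"
    using assms finite_subset[OF B(1)] by auto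
  then show "l \<le> stratum \<F> w"
    unfolding stratum_def B(2)[symmetric] using assms by (intro card_mono) auto
next
  assume "l \<le> stratum \<F> w"
  then obtain B where B: "B \<subseteq> {f\<in>\<F>. f w \<noteq> 0}" "card B = l"
    unfolding stratum_def by (meson obtain_subset_with_card_n)
  show "0 < stratum_height \<F> l w"
    unfolding stratum_height_def
  proof (rule sum_pos2[of _ B])
    show "0 < (\<Prod>f\<in>B. \<bar>f w\<bar>)" using B by (intro prod_pos) auto
  qed (use B assms in \<open>auto intro: prod_nonneg\<close>)
qed

text \<open>Nonzero functions keep their sign nearby, so the set of nonvanishing functions can only
  grow. In the same stratum its cardinality is unchanged, hence the zeros persist as well.\<close>

lemma stratum_sgn_locally_constant:
  assumes h: "cylinder_base h" and fin: "finite \<F>"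
    and cont: "\<And>f. f \<in> \<F> \<Longrightarrow> continuous_on X f" and w: "w \<in> X"
  obtains n where "\<forall>u\<in>X. agree h n w u \<longrightarrow> stratum \<F> u = stratum \<F> w \<longrightarrow>
    (\<forall>f\<in>\<F>. sgn (f u) = sgn (f w))"
proof -
  have "\<exists>n. \<forall>u\<in>X. agree h n w u \<longrightarrow> f w \<noteq> 0 \<longrightarrow> sgn (f u) = sgn (f w)" if fF: "f \<in> \<F>" for f
  proof (cases "f w = 0")
    case False
    then obtain n where n: "\<forall>u\<in>X. agree h n w u \<longrightarrow> \<bar>f u - f w\<bar> < \<bar>f w\<bar>"
      using cont[OF fF] w unfolding continuous_on_cylinder_real[OF h] by (meson zero_less_abs_iff)
    have "sgn (f u) = sgn (f w)" if "u \<in> X" "agree h n w u" for u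
      using n[rule_format, OF that] by (auto simp: sgn_if abs_if split: if_splits)
    then show ?thesis by blast
  qed auto
  then obtain N where N: "\<And>f u. f \<in> \<F> \<Longrightarrow> u \<in> X \<Longrightarrow> agree h (N f) w u \<Longrightarrow> f w \<noteq> 0 \<Longrightarrow> sgn (f u) = sgn (f w)"
    by metis
  define n where "n = Max (insert 0 (N ` \<F>))"
  have n: "N f \<le> n" if "f \<in> \<F>" for f
    unfolding n_def using fin that by (intro Max_ge) auto
  show thesis
  proof (rule that, intro ballI impI)
    fix u f assume u: "u \<in> X" "agree h n w u" "stratum \<F> u = stratum \<F> w" and f: "f \<in> \<F>"
    have sg: "sgn (f u) = sgn (f w)" if "f \<in> \<F>" "f w \<noteq> 0" for f
      using N[OF that(1) u(1) agree_mono[OF u(2) n[OF that(1)]] that(2)] .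
    have "f u \<noteq> 0" if "f \<in> \<F>" "f w \<noteq> 0" for f
      using sg[OF that] that(2) by (metis sgn_0_0)
    then have "{f\<in>\<F>. f w \<noteq> 0} \<subseteq> {f\<in>\<F>. f u \<noteq> 0}" by blast
    then have "{f\<in>\<F>. f w \<noteq> 0} = {f\<in>\<F>. f u \<noteq> 0}"
      using u(3) fin unfolding stratum_def by (intro card_subset_eq) auto
    then have "f u = 0" if "f w = 0" using f that by blast
    then show "sgn (f u) = sgn (f w)"
      using sg[OF f] by (cases "f w = 0") simp_all
  qed
qed

lemma hull_of_subset_polytope:
  assumes "\<And>c. c < M \<Longrightarrow> v c \<in> polytope_of m R" "x \<in> hull_of m M v"
  shows "x \<in> polytope_of m R"
proof -
  obtain t where t: "t \<in> simplex M" "\<And>j. j < m \<Longrightarrow> x j = comb M t v j"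
    using assms(2) by (auto simp: hull_of_def)
  have "dotp m a x \<le> b" if ab: "(a, b) \<in> R" for a b
  proof -
    have "dotp m a x = (\<Sum>j<m. \<Sum>c<M. t c * (a j * v c j))"
      unfolding dotp_def by (rule sum.cong) (auto simp: t(2) comb_def sum_distrib_left algebra_simps)
    also have "\<dots> = (\<Sum>c<M. t c * dotp m a (v c))"
      by (subst sum.swap) (simp add: dotp_def sum_distrib_left)
    also have "\<dots> \<le> (\<Sum>c<M. t c * b)"
      using t(1) assms(1) ab by (intro sum_mono mult_left_mono) (auto simp: simplex_def polytope_of_def)
    also have "\<dots> = b" using t(1) by (simp add: simplex_def flip: sum_distrib_right)
    finally show ?thesis .
  qed
  then show ?thesis by (auto simp: polytope_of_def)
qed

lemma polytope_of_cong:
  "(\<And>j. j < m \<Longrightarrow> x j = y j) \<Longrightarrow> x \<in> polytope_of m R \<longleftrightarrow> y \<in> polytope_of m R"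
  using dotp_cong[of m x y] by (simp add: polytope_of_def)

text \<open>The list enumerates the feasible candidates. These include all basic points of the
  polytope, and which candidates are feasible depends only on the signs of the functions in
  \<open>\<F>\<close>, so the choice is locally constant on each stratum.\<close>

lemma stratified_vertices:
  fixes R :: "'w::topological_space prow set" and h :: "'w \<Rightarrow> nat \<Rightarrow> nat"
  assumes h: "cylinder_base h" and fin: "finite R" and cont: "cont_prows X R"
    and ne: "\<And>w. w \<in> X \<Longrightarrow> polytope_of m (inst R w) \<noteq> {}"
    and bnd: "\<forall>w\<in>X. \<forall>x\<in>polytope_of m (inst R w). \<forall>j<m. x j \<in> {0..1}"
  obtains M \<F> v where "0 < M" "finite \<F>" "\<And>f. f \<in> \<F> \<Longrightarrow> continuous_on X f"
    "\<And>l c j. continuous_on {w\<in>X. stratum \<F> w = l} (\<lambda>w. v w c j :: real)"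
    "\<And>w c j. w \<in> X \<Longrightarrow> v w c j \<in> {0..1}"
    "\<And>w. w \<in> X \<Longrightarrow> hull_of m M (v w) = polytope_of m (inst R w)"
proof -
  define C where "C = cands m R"
  have "finite C" unfolding C_def by (rule finite_cands[OF fin])
  then obtain e where e: "bij_betw e {..<card C} C"
    using ex_bij_betw_nat_finite by (metis atLeast0LessThan)
  \<comment> \<open>The successor makes the list nonempty even if there is no candidate.\<close>
  define M where "M = Suc (card C)"
  define num where "num c = fst (e c)" for c
  define den where "den c = snd (e c)" for c
  have eC: "(num c, den c) \<in> C" if "c < card C" for c
    using e that by (auto simp: num_def den_def bij_betw_def)
  have Ce: "\<exists>c<card C. N = num c \<and> D = den c" if "(N, D) \<in> C" for N D
    using e that unfolding bij_betw_def num_def den_def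
    by (metis (no_types, lifting) fst_conv imageE lessThan_iff snd_conv)
  have contC: "continuous_on X (\<lambda>w. num c w j)" "continuous_on X (den c)" if "c < card C" for c j
    using cont_cands[OF cont, of m] eC[OF that] by (auto simp: cont_prows_def C_def)
  define res where "res = (\<lambda>(a, b) c w. (dotp m (a w) (num c w) - b w * den c w) * den c w)"
  define \<F> where "\<F> = den ` {..<card C} \<union> (\<lambda>(r, c). res r c) ` (R \<times> {..<card C})"
  have fin\<F>: "finite \<F>" unfolding \<F>_def using fin by auto
  have cont\<F>: "continuous_on X f" if "f \<in> \<F>" for f
  proof -
    have "continuous_on X (res (a, b) c)" if "(a, b) \<in> R" "c < card C" for a b c
    proof -
      have [continuous_intros]: "continuous_on X (\<lambda>w. a w j)" "continuous_on X b" for j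
        using cont that by (auto simp: cont_prows_def)
      show ?thesis
        unfolding res_def dotp_def using contC[OF that(2)] by (auto intro!: continuous_intros)
    qed
    then show ?thesis using that contC unfolding \<F>_def by auto
  qed
  define \<Phi> where "\<Phi> w = {c. c < card C \<and> feasible_at m R (num c, den c) w}" for w
  \<comment> \<open>Infeasible positions repeat the first feasible candidate: the list keeps a fixed
    length and never leaves the polytope.\<close>
  define sel where "sel w c = (if c \<in> \<Phi> w then c else (LEAST c. c \<in> \<Phi> w))" for w c
  define v where "v w c j = (if j < m then num (sel w c) w j / den (sel w c) w else 0)" for w c j
  have \<Phi>_cong: "\<Phi> u = \<Phi> w" if sg: "\<And>f. f \<in> \<F> \<Longrightarrow> sgn (f u) = sgn (f w)" for u w
  proof -
    have "feasible_at m R (num c, den c) u \<longleftrightarrow> feasible_at m R (num c, den c) w" if c: "c < card C" for c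
    proof -
      have "den c \<in> \<F>" using c by (auto simp: \<F>_def)
      then have 1: "den c u = 0 \<longleftrightarrow> den c w = 0" using sg[of "den c"] by (metis sgn_0_0)
      have "res r c u \<le> 0 \<longleftrightarrow> res r c w \<le> 0" if "r \<in> R" for r
      proof -
        have "res r c \<in> \<F>" using c that by (auto simp: \<F>_def)
        then have "sgn (res r c u) = sgn (res r c w)" by (rule sg)
        then show ?thesis by (auto simp: sgn_if split: if_splits)
      qed
      then show ?thesis using 1 by (fastforce simp: feasible_at_def res_def)
    qed
    then show ?thesis by (auto simp: \<Phi>_def)
  qed
  have basic\<Phi>: "\<exists>c\<in>\<Phi> w. \<forall>j<m. x j = v w c j"
    if x: "x \<in> polytope_of m (inst R w)" and bx: "basic_point m (inst R w) x" for w x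
  proof -
    obtain N D where ND: "(N, D) \<in> C" "D w \<noteq> 0" "\<forall>j<m. x j = N w j / D w"
      using basic_point_cands[OF bx] by (auto simp: C_def)
    then have "(\<lambda>j. N w j / D w) \<in> polytope_of m (inst R w)"
      using x polytope_of_cong[of m x "\<lambda>j. N w j / D w"] by auto
    then have "feasible_at m R (N, D) w" using ND(2) by (simp add: feasible_at_iff)
    moreover obtain c where "c < card C" "N = num c" "D = den c" using Ce[OF ND(1)] by auto
    ultimately have "c \<in> \<Phi> w" "\<forall>j<m. x j = v w c j"
      using ND(3) by (auto simp: \<Phi>_def v_def sel_def)
    then show ?thesis by blast
  qed
  have hull: "x \<in> hull_of m M (v w)" if w: "w \<in> X" and x: "x \<in> polytope_of m (inst R w)" for w x
  proof (rule polytope_basic_induct[where H = "hull_of m M (v w)" and m = m and R = "inst R w"])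
    show "finite (inst R w)" using fin by (simp add: inst_def)
    show "y j \<in> {0..1}" if "y \<in> polytope_of m (inst R w)" "j < m" for y j
      by (rule bnd[rule_format, OF w that])
    show "x \<in> polytope_of m (inst R w)" by (rule x)
    fix y assume "y \<in> polytope_of m (inst R w)" "basic_point m (inst R w) y"
    then obtain c where c: "c \<in> \<Phi> w" "\<forall>j<m. y j = v w c j" using basic\<Phi> by blast
    then have "c < M" by (simp add: \<Phi>_def M_def)
    then have "(\<lambda>i. if i = c then 1 else 0) \<in> simplex M" "comb M (\<lambda>i. if i = c then 1 else 0) (v w) = v w c"
      by (auto simp: simplex_def comb_def if_distrib[of "\<lambda>x. x * _"] cong: if_cong)
    then show "y \<in> hull_of m M (v w)" using c unfolding hull_of_def by force
  next
    fix y z u assume "y \<in> hull_of m M (v w)" "z \<in> hull_of m M (v w)" and u: "0 \<le> u" "u \<le> (1::real)"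
    then obtain s t where "s \<in> simplex M" "\<forall>j<m. y j = comb M s (v w) j"
      "t \<in> simplex M" "\<forall>j<m. z j = comb M t (v w) j" by (auto simp: hull_of_def)
    then show "(\<lambda>j. (1 - u) * y j + u * z j) \<in> hull_of m M (v w)"
      using u simplex_segment[of s M t u] unfolding hull_of_def
      by (auto simp: comb_segment intro!: bexI[of _ "\<lambda>c. (1 - u) * s c + u * t c"])
  qed
  have sel\<Phi>: "sel w c \<in> \<Phi> w" if w: "w \<in> X" for w c
  proof -
    have "\<Phi> w \<noteq> {}"
    proof
      assume "\<Phi> w = {}"
      obtain x where x: "x \<in> polytope_of m (inst R w)" using ne[OF w] by blast
      \<comment> \<open>Without feasible candidates the polytope has no basic point, and the
        induction with the empty set contradicts its nonemptiness.\<close>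
      have "x \<in> {}"
      proof (rule polytope_basic_induct[where H = "{}" and m = m and R = "inst R w"])
        show "y j \<in> {0..1}" if "y \<in> polytope_of m (inst R w)" "j < m" for y j
          by (rule bnd[rule_format, OF w that])
      qed (use x fin basic\<Phi> \<open>\<Phi> w = {}\<close> in \<open>auto simp: inst_def\<close>)
      then show False by simp
    qed
    then show ?thesis unfolding sel_def by (auto intro: LeastI_ex)
  qed
  have den_sel: "sel w c < card C" "den (sel w c) w \<noteq> 0" if "w \<in> X" for w c
    using sel\<Phi>[OF that, of c] by (auto simp: \<Phi>_def feasible_at_iff)
  have vP: "v w c \<in> polytope_of m (inst R w)" if w: "w \<in> X" for w c
  proof -
    have "(\<lambda>j. num (sel w c) w j / den (sel w c) w) \<in> polytope_of m (inst R w)"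
      using sel\<Phi>[OF w, of c] by (auto simp: \<Phi>_def feasible_at_iff)
    then show ?thesis
      using polytope_of_cong[of m "v w c" "\<lambda>j. num (sel w c) w j / den (sel w c) w"] by (simp add: v_def)
  qed
  show thesis
  proof (rule that[of M \<F> v])
    show "0 < M" by (simp add: M_def)
    show "v w c j \<in> {0..1}" if "w \<in> X" for w c j
      using bnd[rule_format, OF that vP[OF that], of j c] by (cases "j < m") (auto simp: v_def)
    show "hull_of m M (v w) = polytope_of m (inst R w)" if "w \<in> X" for w
      using hull[OF that] hull_of_subset_polytope[of M "v w" m "inst R w"] vP[OF that] by blast
    show "continuous_on {w\<in>X. stratum \<F> w = l} (\<lambda>w. v w c j)" for l c j
      unfolding continuous_on_cylinder_real[OF h]
    proof (intro ballI allI impI)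
      fix w and \<epsilon> :: real assume "w \<in> {w \<in> X. stratum \<F> w = l}" and \<epsilon>: "0 < \<epsilon>"
      then have w: "w \<in> X" and l: "stratum \<F> w = l" by auto
      obtain n where n: "\<forall>u\<in>X. agree h n w u \<longrightarrow> stratum \<F> u = stratum \<F> w \<longrightarrow>
          (\<forall>f\<in>\<F>. sgn (f u) = sgn (f w))"
        by (rule stratum_sgn_locally_constant[OF h fin\<F> cont\<F> w])
      define k where "k = sel w c"
      have k: "k < card C" "den k w \<noteq> 0" using den_sel[OF w] by (auto simp: k_def)
      have "continuous_on {u\<in>X. den k u \<noteq> 0} (\<lambda>u. num k u j / den k u)"
        by (intro continuous_on_divide continuous_on_subset[OF contC(1)[OF k(1)]]
            continuous_on_subset[OF contC(2)[OF k(1)]]) auto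
      then obtain n' where n': "\<forall>u\<in>{u\<in>X. den k u \<noteq> 0}. agree h n' w u \<longrightarrow>
          \<bar>num k u j / den k u - num k w j / den k w\<bar> < \<epsilon>"
        using w k \<epsilon> unfolding continuous_on_cylinder_real[OF h] by blast
      have "\<bar>v u c j - v w c j\<bar> < \<epsilon>"
        if u: "u \<in> X" "stratum \<F> u = l" "agree h (max n n') w u" for u
      proof -
        have ag: "agree h n w u" "agree h n' w u" using u(3) by (auto elim: agree_mono)
        have "\<Phi> u = \<Phi> w" using n u(1,2) ag(1) l by (intro \<Phi>_cong) auto
        then have "sel u c = k" by (simp add: sel_def k_def)
        then show ?thesis
          using n' den_sel[OF u(1), of c] u(1) ag(2) \<epsilon> by (auto simp: v_def k_def)
      qed
      then show "\<exists>n. \<forall>u\<in>{w \<in> X. stratum \<F> w = l}. agree h n w u \<longrightarrow> \<bar>v u c j - v w c j\<bar> < \<epsilon>"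
        by (intro exI[of _ "max n n'"]) auto
    qed
  qed (use fin\<F> cont\<F> in auto)
qed


section \<open>Solving with independent robust divisions\<close>

lemma agree_sequence_tendsto:
  fixes f :: "'w::topological_space \<Rightarrow> real"
  assumes h: "cylinder_base h" and f: "continuous_on X f" and w: "w \<in> X"
    and W: "\<And>n. W n \<in> X" "\<And>n. agree h n w (W n)" and r: "strict_mono r"
  shows "(\<lambda>n. f (W (r n))) \<longlonglongrightarrow> f w"
proof (rule LIMSEQ_I)
  fix e :: real assume "0 < e"
  then obtain n where n: "\<And>u. u \<in> X \<Longrightarrow> agree h n w u \<Longrightarrow> \<bar>f u - f w\<bar> < e"
    using f w unfolding continuous_on_cylinder_real[OF h] by blast
  have "norm (f (W (r k)) - f w) < e" if "n \<le> k" for k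
    using n[OF W(1) agree_mono[OF W(2)]] that strict_mono_imp_increasing[OF r, of k]
    by (simp add: order_trans)
  then show "\<exists>n0. \<forall>k\<ge>n0. norm (f (W (r k)) - f w) < e" by blast
qed

text \<open>Compactness: otherwise points of polytopes at parameters tending to \<open>w\<close>
  stay away from the hulls. A limit point satisfies the limit inequalities, so it lies in the hull
  at \<open>w\<close>, and continuity of the nearest point gives a contradiction.\<close>

lemma hull_excess_small:
  fixes R :: "'w::topological_space prow set" and h :: "'w \<Rightarrow> nat \<Rightarrow> nat"
  assumes h: "cylinder_base h" and cont: "cont_prows X R" and UX: "U \<subseteq> X" and M: "0 < M"
    and bnd: "\<forall>w\<in>X. \<forall>x\<in>polytope_of m (inst R w). \<forall>j<m. x j \<in> {0..1}"
    and v: "\<And>c j. continuous_on U (\<lambda>w. v w c j :: real)"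
    and w: "w \<in> U" and hull: "polytope_of m (inst R w) \<subseteq> hull_of m M (v w)" and e: "0 < e"
  shows "\<exists>n. \<forall>u\<in>U. agree h n w u \<longrightarrow>
    (\<forall>g\<in>polytope_of m (inst R u). \<forall>j<m. \<bar>g j - nearest m M (v u) g j\<bar> < e)"
proof (rule ccontr)
  assume "\<not> ?thesis"
  then have "\<forall>n. \<exists>u g j. u \<in> U \<and> agree h n w u \<and> g \<in> polytope_of m (inst R u) \<and> j < m \<and>
      e \<le> \<bar>g j - nearest m M (v u) g j\<bar>"
    by (meson not_less)
  then obtain W G J where W: "\<And>n. W n \<in> U" "\<And>n. agree h n w (W n)"
    and G: "\<And>n. G n \<in> polytope_of m (inst R (W n))" and J: "\<And>n. J n < m"
    and far: "\<And>n. e \<le> \<bar>G n (J n) - nearest m M (v (W n)) (G n) (J n)\<bar>"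
    by metis
  \<comment> \<open>Clearing the coordinates from \<open>m\<close> on keeps the sequence in the
    compact box.\<close>
  define H where "H n j = (if j < m then G n j else 0)" for n j
  have HG: "H n j = G n j" if "j < m" for n j using that by (simp add: H_def)
  have "H n \<in> {t. \<forall>c. t c \<in> {0..1}}" for n
    using bnd[rule_format, OF subsetD[OF UX W(1)] G] by (auto simp: H_def)
  then obtain g r where r: "strict_mono r" and g: "(H \<circ> r) \<longlonglongrightarrow> g"
    using compact_imp_seq_compact[OF compact_box] unfolding seq_compact_def by metis
  have gj: "(\<lambda>n. H (r n) j) \<longlonglongrightarrow> g j" for j
    using continuous_on_tendsto_compose[OF continuous_on_product_coordinates g, of j]
    by (simp add: o_def)
  have WX: "W n \<in> X" and wX: "w \<in> X" for n using W(1) w UX by auto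
  have "dotp m (a w) g \<le> b w" if ab: "(a, b) \<in> R" for a b
  proof (rule LIMSEQ_le)
    have c: "continuous_on X (\<lambda>w. a w j)" "continuous_on X b" for j
      using cont ab by (auto simp: cont_prows_def)
    show "(\<lambda>n. b (W (r n))) \<longlonglongrightarrow> b w"
      by (rule agree_sequence_tendsto[OF h c(2) wX WX W(2) r])
    show "(\<lambda>n. dotp m (a (W (r n))) (H (r n))) \<longlonglongrightarrow> dotp m (a w) g"
      unfolding dotp_def
      by (intro tendsto_sum tendsto_mult gj agree_sequence_tendsto[OF h c(1) wX WX W(2) r])
    have "dotp m (a (W k)) (H k) \<le> b (W k)" for k
      using G[of k] ab dotp_cong[of m "H k" "G k" "a (W k)"] HG
      by (fastforce simp: polytope_of_def inst_def)
    then show "\<exists>N. \<forall>n\<ge>N. dotp m (a (W (r n))) (H (r n)) \<le> b (W (r n))" by blast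
  qed
  then have "g \<in> polytope_of m (inst R w)" by (auto simp: polytope_of_def inst_def)
  then have gh: "g \<in> hull_of m M (v w)" using hull by blast
  define D where "D n j = G (r n) j - nearest m M (v (W (r n))) (G (r n)) j" for n j
  have "(\<lambda>n. D n j) \<longlonglongrightarrow> g j - nearest m M (v w) g j" if "j < m" for j
    unfolding D_def
  proof (intro tendsto_diff tendsto_nearest[OF M])
    show "(\<lambda>n. G (r n) i) \<longlonglongrightarrow> g i" if "i < m" for i using gj[of i] HG[OF that] by simp
    show "(\<lambda>n. v (W (r n)) c i) \<longlonglongrightarrow> v w c i" for c i
      by (rule agree_sequence_tendsto[OF h v w W r])
  qed (use that gj[of j] HG[OF that] in auto)
  \<comment> \<open>The bad coordinate \<open>J n\<close> varies with \<open>n\<close>, hence the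
    sum over all coordinates.\<close>
  then have "(\<lambda>n. \<Sum>j<m. \<bar>D n j\<bar>) \<longlonglongrightarrow> (\<Sum>j<m. \<bar>g j - nearest m M (v w) g j\<bar>)"
    by (intro tendsto_sum tendsto_rabs) auto
  also have "(\<Sum>j<m. \<bar>g j - nearest m M (v w) g j\<bar>) = 0"
    using nearest_eq[OF gh M] by simp
  finally have "eventually (\<lambda>n. (\<Sum>j<m. \<bar>D n j\<bar>) < e) sequentially"
    using e by (rule order_tendstoD)
  then obtain n where n: "(\<Sum>j<m. \<bar>D n j\<bar>) < e" by (auto simp: eventually_sequentially)
  have "\<bar>D n (J (r n))\<bar> \<le> (\<Sum>j<m. \<bar>D n j\<bar>)"
    using J by (intro member_le_sum) auto
  then show False using n far[of "r n"] by (simp add: D_def)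
qed

text \<open>The offset from the nearest point is clamped coordinatewise. The absolute value keeps
  the clamping interval nonempty when \<open>\<epsilon>\<close> is an arbitrary, possibly negative,
  answer of a division.\<close>

definition pull :: "nat \<Rightarrow> nat \<Rightarrow> (nat \<Rightarrow> point) \<Rightarrow> real \<Rightarrow> point \<Rightarrow> point" where
  "pull m M V \<epsilon> g = (\<lambda>j. nearest m M V g j + max (- \<bar>\<epsilon>\<bar>) (min \<bar>\<epsilon>\<bar> (g j - nearest m M V g j)))"

lemma pull_zero: "0 < M \<Longrightarrow> pull m M V 0 g \<in> hull_of m M V"
  using nearest_in_hull[of M m V g] by (simp add: pull_def)

lemma pull_close: "\<bar>g j - nearest m M V g j\<bar> \<le> \<epsilon> \<Longrightarrow> pull m M V \<epsilon> g j = g j"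
  by (auto simp: pull_def max_def min_def)

lemma continuous_pull:
  assumes "0 < M" "\<And>c j. continuous_on X (\<lambda>q. V q c j)" "continuous_on X \<epsilon>"
    and "\<And>j. j < m \<Longrightarrow> continuous_on X (\<lambda>q. g q j)" "j < m"
  shows "continuous_on X (\<lambda>q. pull m M (V q) (\<epsilon> q) (g q) j)"
  unfolding pull_def
  by (intro continuous_intros continuous_on_max continuous_on_min continuous_nearest assms)

primrec chain :: "(nat \<Rightarrow> 'b \<Rightarrow> 'b) \<Rightarrow> nat \<Rightarrow> 'b \<Rightarrow> 'b" where
  "chain \<phi> 0 g = g"
| "chain \<phi> (Suc n) g = chain \<phi> n (\<phi> n g)"

text \<open>The outer maps \<open>\<phi> k\<close>, \<open>k < l\<close>, preserve \<open>P\<close>, and \<open>\<phi> l\<close> repairs whatever the inner ones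
  have done.\<close>

lemma chain_in:
  assumes "\<And>k g. k < l \<Longrightarrow> g \<in> P \<Longrightarrow> \<phi> k g \<in> P" "\<And>g. \<phi> l g \<in> P" "l < n"
  shows "chain \<phi> n g \<in> P"
proof -
  have pres: "chain \<phi> k g \<in> P" if "k \<le> l" "g \<in> P" for k g
    using that by (induction k arbitrary: g) (auto simp: assms(1))
  show ?thesis using assms(3)
  proof (induction n arbitrary: g)
    case (Suc n)
    then show ?case using pres[of l] assms(2) by (cases "n = l") auto
  qed simp
qed

text \<open>At zeros of \<open>d\<close> the bound on \<open>f\<close> forces the product to 0,
  however \<open>f\<close> behaves; elsewhere \<open>d\<close> stays positive nearby.\<close>

lemma continuous_on_mult_vanishing:
  fixes d f :: "'w::topological_space \<Rightarrow> real" and h :: "'w \<Rightarrow> nat \<Rightarrow> nat"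
  assumes h: "cylinder_base h" and d: "continuous_on X d" "\<And>w. 0 \<le> d w"
    and f: "continuous_on {w\<in>X. 0 < d w} f" "\<And>w. f w \<in> {0..1}"
  shows "continuous_on X (\<lambda>w. d w * f w)"
  unfolding continuous_on_cylinder_real[OF h]
proof (intro ballI allI impI)
  fix w and e :: real assume w: "w \<in> X" and e: "0 < e"
  \<comment> \<open>For \<open>d w > 0\<close> this radius keeps \<open>d u\<close> positive, so
    that continuity of \<open>f\<close> applies at \<open>u\<close>.\<close>
  obtain n where n: "\<forall>u\<in>X. agree h n w u \<longrightarrow> \<bar>d u - d w\<bar> < (if d w = 0 then e else d w)"
    using d(1) w e d(2)[of w] unfolding continuous_on_cylinder_real[OF h]
    by (metis order_le_less)
  show "\<exists>n. \<forall>u\<in>X. agree h n w u \<longrightarrow> \<bar>d u * f u - d w * f w\<bar> < e"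
  proof (cases "d w = 0")
    case True
    have "\<bar>d u * f u - d w * f w\<bar> < e" if u: "u \<in> X" "agree h n w u" for u
    proof -
      have "d u * f u \<le> d u" using f(2)[of u] d(2)[of u] by (simp add: mult_left_le)
      then show ?thesis
        using n[rule_format, OF u] True f(2)[of u] d(2)[of u] by auto
    qed
    then show ?thesis by blast
  next
    case False
    then have dw: "0 < d w" using d(2)[of w] by simp
    have "continuous_on {w\<in>X. 0 < d w} (\<lambda>w. d w * f w)"
      by (intro continuous_on_mult f(1) continuous_on_subset[OF d(1)]) auto
    then obtain n' where n': "\<forall>u\<in>{w\<in>X. 0 < d w}. agree h n' w u \<longrightarrow> \<bar>d u * f u - d w * f w\<bar> < e"
      using w dw e unfolding continuous_on_cylinder_real[OF h] by blast
    have "\<bar>d u * f u - d w * f w\<bar> < e" if u: "u \<in> X" "agree h (max n n') w u" for u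
    proof -
      have ag: "agree h n w u" "agree h n' w u" using u(2) by (auto elim: agree_mono)
      have "0 < d u" using n[rule_format, OF u(1) ag(1)] False by (auto simp: abs_if split: if_splits)
      then show ?thesis using n' u(1) ag(2) by blast
    qed
    then show ?thesis by blast
  qed
qed

text \<open>Supplies the list and the tolerance of one stratum: the list is extended from
  \<open>S\<close> to \<open>U\<close>, and the tolerance majorises the distances from its hull,
  which \<open>hull_excess_small\<close> makes small near \<open>S\<close>.\<close>

lemma stratum_data:
  fixes R :: "'w::topological_space prow set" and h :: "'w \<Rightarrow> nat \<Rightarrow> nat"
  assumes h: "cylinder_base h" and cont: "cont_prows X R"
    and bnd: "\<forall>w\<in>X. \<forall>x\<in>polytope_of m (inst R w). \<forall>j<m. x j \<in> {0..1}"
    and M: "0 < M" and SU: "S \<subseteq> U" and UX: "U \<subseteq> X"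
    and clo: "\<And>x. x \<in> U - S \<Longrightarrow> \<exists>n. \<forall>y\<in>S. \<not> agree h n x y"
    and v: "\<And>c j. continuous_on S (\<lambda>w. v w c j :: real)"
    and v01: "\<And>w c j. w \<in> S \<Longrightarrow> v w c j \<in> {0..1}"
    and hull: "\<And>w. w \<in> S \<Longrightarrow> hull_of m M (v w) = polytope_of m (inst R w)"
  shows "\<exists>V \<epsilon>. (\<forall>c j. continuous_on U (\<lambda>w. V w c j)) \<and> continuous_on U \<epsilon> \<and>
    (\<forall>w c j. V w c j \<in> {0..1}) \<and> (\<forall>w. \<epsilon> w \<in> {0..1}) \<and>
    (\<forall>w\<in>S. \<epsilon> w = 0 \<and> hull_of m M (V w) = polytope_of m (inst R w)) \<and>
    (\<forall>w\<in>U. \<forall>g\<in>polytope_of m (inst R w). \<forall>j<m. \<bar>g j - nearest m M (V w) g j\<bar> \<le> \<epsilon> w)"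
proof -
  obtain V' where V': "\<And>i. continuous_on U (\<lambda>w. V' w i)"
    "\<And>w. w \<in> S \<Longrightarrow> V' w = (\<lambda>(c, j). v w c j)" "\<And>w i. V' w i \<in> {0..1}"
  proof (rule extend_from_closed[OF h SU clo, where f = "\<lambda>w (c, j). v w c j"])
    show "continuous_on S (\<lambda>w. case i of (c, j) \<Rightarrow> v w c j)" for i using v by (cases i) simp
    show "(case i of (c, j) \<Rightarrow> v w c j) \<in> {0..1}" if "w \<in> S" for w i using v01[OF that] by (cases i) auto
  qed auto
  define V where "V w c j = V' w (c, j)" for w c j
  have V: "continuous_on U (\<lambda>w. V w c j)" "V w c j \<in> {0..1}" for w c j
    using V' by (auto simp: V_def)
  have VS: "V w = v w" if "w \<in> S" for w using V'(2)[OF that] by (simp add: V_def fun_eq_iff)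
  define E where "E w = {\<bar>g j - nearest m M (V w) g j\<bar> | g j. g \<in> polytope_of m (inst R w) \<and> j < m}" for w
  \<comment> \<open>A convex combination of numbers in the unit interval; this puts the distances
    into the range that \<open>continuous_majorant\<close> demands.\<close>
  have near01: "nearest m M (V w) g j \<in> {0..1}" for w g j
  proof -
    let ?t = "nearest_weights m M (V w) g"
    have t: "?t \<in> simplex M" by (rule nearest_weights(1)[OF M])
    then have "0 \<le> ?t c * V w c j" "?t c * V w c j \<le> ?t c" for c
      using V(2)[of w c j] by (auto simp: simplex_def mult_left_le)
    then have "0 \<le> (\<Sum>c<M. ?t c * V w c j)" "(\<Sum>c<M. ?t c * V w c j) \<le> (\<Sum>c<M. ?t c)"
      by (auto intro: sum_nonneg sum_mono)
    then show ?thesis using t by (simp add: nearest_def comb_def simplex_def)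
  qed
  obtain \<epsilon> where \<epsilon>: "continuous_on U \<epsilon>" "\<And>w. w \<in> S \<Longrightarrow> \<epsilon> w = 0" "\<And>w. \<epsilon> w \<in> {0..1}"
    "\<And>w t. w \<in> U \<Longrightarrow> t \<in> E w \<Longrightarrow> t \<le> \<epsilon> w"
  proof (rule continuous_majorant[OF h SU clo, where E = E])
    show "E w \<subseteq> {0..1}" if "w \<in> U" for w
    proof -
      have "\<bar>g j - nearest m M (V w) g j\<bar> \<in> {0..1}" if "g \<in> polytope_of m (inst R w)" "j < m" for g j
        using bnd[rule_format, OF subsetD[OF UX \<open>w \<in> U\<close>] that] near01[of w g j] by auto
      then show ?thesis by (auto simp: E_def)
    qed
    show "\<exists>n. \<forall>u\<in>U. agree h n w u \<longrightarrow> (\<forall>t\<in>E u. t < e)" if "w \<in> S" "0 < e" for w e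
    proof -
      have "w \<in> U" "polytope_of m (inst R w) \<subseteq> hull_of m M (V w)"
        using that SU hull VS by auto
      from hull_excess_small[where m = m and R = R and X = X and U = U and M = M and v = V, OF h cont UX M bnd V(1) this that(2)]
      show ?thesis by (auto simp: E_def)
    qed
  qed auto
  have "\<forall>w\<in>U. \<forall>g\<in>polytope_of m (inst R w). \<forall>j<m. \<bar>g j - nearest m M (V w) g j\<bar> \<le> \<epsilon> w"
    using \<epsilon>(4) unfolding E_def by blast
  then show ?thesis using V \<epsilon>(1-3) VS hull by (intro exI[of _ V] exI[of _ \<epsilon>]) auto
qed

text \<open>The dividends and divisors depend on \<open>w\<close> alone and \<open>Y\<close> on the
  quotients alone, so all divisions can be posed at once, as one product problem.\<close>

theorem polytope_point_by_robust_division: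
  fixes R :: "'w::topological_space prow set" and h :: "'w \<Rightarrow> nat \<Rightarrow> nat"
  assumes h: "cylinder_base h" and fin: "finite R" and cont: "cont_prows X R"
    and ne: "\<And>w. w \<in> X \<Longrightarrow> polytope_of m (inst R w) \<noteq> {}"
    and bnd: "\<forall>w\<in>X. \<forall>x\<in>polytope_of m (inst R w). \<forall>j<m. x j \<in> {0..1}"
  shows "\<exists>(K :: nat) x y (Y :: point \<Rightarrow> point).
    (\<forall>k. continuous_on X (x k) \<and> continuous_on X (y k) \<and> (\<forall>w. 0 \<le> x k w \<and> x k w \<le> y k w)) \<and>
    (\<forall>j<m. continuous_on UNIV (\<lambda>q. Y q j)) \<and>
    (\<forall>w\<in>X. \<forall>q. (\<forall>k<K. 0 < y k w \<longrightarrow> q k = x k w / y k w) \<longrightarrow> Y q \<in> polytope_of m (inst R w))"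
proof -
  obtain M \<F> v where M: "0 < M" and \<F>: "finite \<F>" "\<And>f. f \<in> \<F> \<Longrightarrow> continuous_on X f"
    and v: "\<And>l c j. continuous_on {w\<in>X. stratum \<F> w = l} (\<lambda>w. v w c j :: real)"
    and v01: "\<And>w c j. w \<in> X \<Longrightarrow> v w c j \<in> {0..1}"
    and hull: "\<And>w. w \<in> X \<Longrightarrow> hull_of m M (v w) = polytope_of m (inst R w)"
    by (rule stratified_vertices[where m = m and R = R and X = X, OF h fin cont ne bnd]) blast+
  define d where "d = stratum_height \<F>"
  have d: "continuous_on X (d l)" "0 \<le> d l w" "0 < d l w \<longleftrightarrow> l \<le> stratum \<F> w" for l w
  proof -
    have "continuous_on X (\<lambda>w. stratum_height \<F> l w)"
      unfolding stratum_height_def by (intro continuous_on_sum continuous_on_prod continuous_on_rabs \<F>(2)) auto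
    then show "continuous_on X (d l)" by (simp add: d_def)
  qed (simp_all add: d_def stratum_height_nonneg stratum_height_pos_iff[OF \<F>(1)])
  define S where "S l = {w\<in>X. stratum \<F> w = l}" for l
  define U where "U l = {w\<in>X. 0 < d l w}" for l
  have "\<exists>V \<epsilon>. (\<forall>c j. continuous_on (U l) (\<lambda>w. V w c j)) \<and> continuous_on (U l) \<epsilon> \<and>
    (\<forall>w c j. V w c j \<in> {0..1}) \<and> (\<forall>w. \<epsilon> w \<in> {0..1}) \<and>
    (\<forall>w\<in>S l. \<epsilon> w = 0 \<and> hull_of m M (V w) = polytope_of m (inst R w)) \<and>
    (\<forall>w\<in>U l. \<forall>g\<in>polytope_of m (inst R w). \<forall>j<m. \<bar>g j - nearest m M (V w) g j\<bar> \<le> \<epsilon> w)" for l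
  proof (rule stratum_data[where m = m and R = R and X = X and U = "U l" and S = "S l" and v = v, OF h cont bnd M])
    show "\<exists>n. \<forall>u\<in>S l. \<not> agree h n w u" if w: "w \<in> U l - S l" for w
    proof -
      \<comment> \<open>A point of \<open>U l\<close> outside stratum \<open>l\<close> lies in a
        higher one, where \<open>d (Suc l)\<close> is positive; positivity persists nearby but fails
        on \<open>S l\<close>.\<close>
      have dw: "0 < d (Suc l) w" and wX: "w \<in> X" using w d(3) by (auto simp: S_def U_def)
      then obtain n where n: "\<forall>u\<in>X. agree h n w u \<longrightarrow> \<bar>d (Suc l) u - d (Suc l) w\<bar> < d (Suc l) w"
        using d(1)[of "Suc l"] unfolding continuous_on_cylinder_real[OF h] by blast
      have "\<not> agree h n w u" if u: "u \<in> S l" for u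
      proof
        assume "agree h n w u"
        then have "0 < d (Suc l) u" using n u by (fastforce simp: S_def)
        then show False using u by (simp add: d(3) S_def)
      qed
      then show ?thesis by blast
    qed
  qed (use v v01 hull d(3) in \<open>auto simp: S_def U_def\<close>)
  then obtain V \<epsilon> where V: "\<And>l c j. continuous_on (U l) (\<lambda>w. V l w c j)" "\<And>l w c j. V l w c j \<in> {0..1}"
    and \<epsilon>: "\<And>l. continuous_on (U l) (\<epsilon> l)" "\<And>l w. \<epsilon> l w \<in> {0..1}"
    and S: "\<And>l w. w \<in> S l \<Longrightarrow> \<epsilon> l w = 0" "\<And>l w. w \<in> S l \<Longrightarrow> hull_of m M (V l w) = polytope_of m (inst R w)"
    and close: "\<And>l w g j. w \<in> U l \<Longrightarrow> g \<in> polytope_of m (inst R w) \<Longrightarrow> j < m \<Longrightarrow>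
      \<bar>g j - nearest m M (V l w) g j\<bar> \<le> \<epsilon> l w"
    by metis
  define idx :: "nat \<Rightarrow> nat \<Rightarrow> nat \<Rightarrow> nat" where "idx l c j = prod_encode (l, prod_encode (c, j))" for l c j
  \<comment> \<open>Slot \<open>c = M\<close> holds the tolerance of the level, read at
    \<open>j = 0\<close>; the smaller slots hold the list.\<close>
  define val where "val l c j w = (if c < M then V l w c j else \<epsilon> l w)" for l c j w
  define lev where "lev k = fst (prod_decode k)" for k
  define rest where "rest k = prod_decode (snd (prod_decode k))" for k
  define x where "x k w = d (lev k) w * val (lev k) (fst (rest k)) (snd (rest k)) w" for k w
  define y where "y k = d (lev k)" for k
  \<comment> \<open>The strata are numbered from 0 to \<open>card \<F>\<close>, both
    included.\<close>
  define L where "L = Suc (card \<F>)"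
  define \<phi> where "\<phi> q l = pull m M (\<lambda>c j. if c < M then q (idx l c j) else 0) (q (idx l M 0))"
    for q :: point and l
  define Y where "Y q = chain (\<phi> q) L (\<lambda>_. 0)" for q
  define K where "K = Suc (Max ((\<lambda>(l, c, j). idx l c j) ` ({..L} \<times> {..M} \<times> {..m})))"
  have K: "idx l c j < K" if "l \<le> L" "c \<le> M" "j \<le> m" for l c j
    unfolding K_def less_Suc_eq_le
    using that by (intro Max_ge image_eqI[of _ _ "(l, c, j)"]) auto
  have "continuous_on X (x k) \<and> continuous_on X (y k) \<and> (\<forall>w. 0 \<le> x k w \<and> x k w \<le> y k w)" for k
  proof -
    have val01: "val l c j w \<in> {0..1}" for l c j w using V(2) \<epsilon>(2) by (simp add: val_def)
    have "continuous_on (U l) (val l c j)" for l c j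
      using V(1) \<epsilon>(1) by (cases "c < M") (simp_all add: val_def[abs_def])
    then have "continuous_on X (x k)"
      unfolding x_def[abs_def] U_def
      by (intro continuous_on_mult_vanishing[OF h d(1,2) _ val01]) auto
    moreover have "0 \<le> x k w \<and> x k w \<le> y k w" for w
      using val01[of "lev k" "fst (rest k)" "snd (rest k)" w] d(2)[of "lev k" w]
      by (simp add: x_def y_def mult_left_le)
    ultimately show ?thesis using d(1) by (simp add: y_def)
  qed
  moreover have "continuous_on UNIV (\<lambda>q. Y q j)" if "j < m" for j
  proof -
    \<comment> \<open>The start value has to vary with \<open>q\<close>, because each step of the
      chain passes on a point computed from \<open>q\<close>.\<close>
    have "continuous_on UNIV (\<lambda>q. chain (\<phi> q) n (g q) j)"
      if "\<And>j. j < m \<Longrightarrow> continuous_on UNIV (\<lambda>q. g q j)" for n and g :: "point \<Rightarrow> point"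
      using that
    proof (induction n arbitrary: g)
      case 0
      then show ?case using \<open>j < m\<close> by simp
    next
      case (Suc n)
      have "continuous_on UNIV (\<lambda>q. \<phi> q n (g q) j)" if "j < m" for j
        unfolding \<phi>_def
      proof (rule continuous_pull[OF M _ _ Suc.prems that])
        show "continuous_on UNIV (\<lambda>q :: point. if c < M then q (idx n c j) else 0)" for c j
          by (cases "c < M") (simp_all add: continuous_coordinate)
      qed (simp_all add: continuous_coordinate)
      then show ?case using Suc.IH[of "\<lambda>q. \<phi> q n (g q)"] by simp
    qed
    from this[of "\<lambda>_ _. 0"] show ?thesis by (simp add: Y_def)
  qed
  moreover have "Y q \<in> polytope_of m (inst R w)"
    if w: "w \<in> X" and q: "\<forall>k<K. 0 < y k w \<longrightarrow> q k = x k w / y k w" for w q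
  proof -
    define l where "l = stratum \<F> w"
    have l: "l < L" using \<F>(1) by (auto simp: l_def L_def stratum_def less_Suc_eq_le intro: card_mono)
    \<comment> \<open>Up to its own stratum \<open>w\<close> has positive divisors, so those answers
      are correct; beyond it nothing is known about \<open>q\<close>.\<close>
    have wU: "w \<in> U k" if "k \<le> l" for k using w that d(3) by (simp add: U_def l_def)
    have wS: "w \<in> S l" using w by (simp add: S_def l_def)
    have exact: "q (idx k c j) = val k c j w" if "k \<le> l" "c \<le> M" "j \<le> m" for k c j
    proof -
      have "lev (idx k c j) = k" "rest (idx k c j) = (c, j)"
        by (auto simp: lev_def rest_def idx_def)
      moreover have "0 < d k w" using wU[OF that(1)] by (simp add: U_def)
      ultimately show ?thesis
        using q K[of k c j] that l by (simp add: x_def y_def)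
    qed
    \<comment> \<open>Answers at coordinates from \<open>m\<close> on are uncontrolled. The distance
      does not see them, so the same weights are chosen.\<close>
    have near_cong: "nearest m M A g j = nearest m M B g j" if "\<And>c j. c < M \<Longrightarrow> j < m \<Longrightarrow> A c j = B c j" "j < m"
      for A B :: "nat \<Rightarrow> point" and g j
    proof -
      have "comb M t A i = comb M t B i" if "i < m" for t i
        using that \<open>\<And>c j. c < M \<Longrightarrow> j < m \<Longrightarrow> A c j = B c j\<close> by (simp add: comb_def)
      moreover from this have "nearest_weights m M A g = nearest_weights m M B g"
        by (simp add: nearest_weights_def sqdist_def)
      ultimately show ?thesis using that(2) by (simp add: nearest_def)
    qed
    have \<phi>: "\<phi> q k g j = pull m M (V k w) (\<epsilon> k w) g j" if "k \<le> l" "j < m" for k g j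
    proof -
      have "nearest m M (\<lambda>c j. if c < M then q (idx k c j) else 0) g j = nearest m M (V k w) g j"
        by (rule near_cong) (use exact that in \<open>auto simp: val_def\<close>)
      then show ?thesis using exact[of k M 0] that by (simp add: \<phi>_def pull_def val_def)
    qed
    show ?thesis
      unfolding Y_def
    proof (rule chain_in[OF _ _ l])
      fix k g assume k: "k < l" and g: "g \<in> polytope_of m (inst R w)"
      have "\<phi> q k g j = g j" if "j < m" for j
        using \<phi>[of k j g] pull_close[OF close[OF wU g that]] k that by simp
      then show "\<phi> q k g \<in> polytope_of m (inst R w)"
        using g polytope_of_cong[of m "\<phi> q k g" g] by simp
    next
      fix g
      have "pull m M (V l w) 0 g \<in> polytope_of m (inst R w)"
        using pull_zero[OF M, of m "V l w" g] S(2)[OF wS] by simp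
      then show "\<phi> q l g \<in> polytope_of m (inst R w)"
        using polytope_of_cong[of m "\<phi> q l g" "pull m M (V l w) 0 g"] \<phi>[of l _ g] S(1)[OF wS] by simp
    qed
  qed
  ultimately show ?thesis by blast
qed


section \<open>Realization on names\<close>

definition name_value :: "(nat \<Rightarrow> rat) \<Rightarrow> baire \<Rightarrow> real" where
  "name_value \<nu> w = (THE x. rho_name \<nu> w x)"

lemma name_value_eq: "rho_name \<nu> w x \<Longrightarrow> name_value \<nu> w = x"
  unfolding name_value_def using rho_name_unique by blast

text \<open>Two names sharing entry \<open>i\<close> have values at distance at most twice
  \<open>1 / 2 ^ i\<close>.\<close>

lemma continuous_name_value: "continuous_on {w. \<exists>x. rho_name \<nu> w x} (name_value \<nu>)"
  unfolding continuous_on_cylinder_real[OF cylinder_base_id]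
proof (intro ballI allI impI)
  fix w and e :: real assume w: "w \<in> {w. \<exists>x. rho_name \<nu> w x}" and e: "0 < e"
  obtain i where i: "(1 / 2) ^ i < e / 2"
    using real_arch_pow_inv[of "e / 2" "1 / 2"] e by auto
  have "\<bar>name_value \<nu> u - name_value \<nu> w\<bar> < e"
    if u: "u \<in> {w. \<exists>x. rho_name \<nu> w x}" "agree (\<lambda>w. w) (Suc i) w u" for u
  proof -
    have "\<bar>of_rat (\<nu> (w i)) - name_value \<nu> w\<bar> \<le> 1 / 2 ^ i" "\<bar>of_rat (\<nu> (u i)) - name_value \<nu> u\<bar> \<le> 1 / 2 ^ i"
      using w u(1) name_value_eq by (auto simp: rho_name_def)
    moreover have "w i = u i" using u(2) by (simp add: agree_def)
    ultimately show ?thesis using i by (simp add: power_one_over abs_if split: if_splits)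
  qed
  then show "\<exists>n. \<forall>u\<in>{w. \<exists>x. rho_name \<nu> w x}. agree (\<lambda>w. w) n w u \<longrightarrow>
      \<bar>name_value \<nu> u - name_value \<nu> w\<bar> < e"
    by blast
qed

text \<open>Being a strict approximation of \<open>f x\<close> by a given rational is an open
  condition on \<open>x\<close>, and density provides one for each \<open>x\<close>. Hence every
  entry of a name can be selected continuously.\<close>

lemma continuous_name_realizer:
  fixes f :: "'a::topological_space \<Rightarrow> real" and h :: "'a \<Rightarrow> nat \<Rightarrow> nat"
  assumes h: "cylinder_base h" and \<nu>: "bij \<nu>" and f: "continuous_on X f"
  shows "\<exists>r. continuous_on X r \<and> (\<forall>x\<in>X. rho_name \<nu> (r x) (f x))"
proof -
  have "\<exists>\<kappa>. continuous_on X \<kappa> \<and> (\<forall>x\<in>X. x \<in> {x. \<bar>of_rat (\<nu> (\<kappa> x)) - f x\<bar> < 1 / 2 ^ i})" for i :: nat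
  proof -
    let ?O = "\<lambda>k. {x. \<bar>of_rat (\<nu> k) - f x\<bar> < 1 / 2 ^ i}"
    have cov: "\<exists>k n. \<forall>y\<in>X. agree h n x y \<longrightarrow> y \<in> ?O k" if x: "x \<in> X" for x
    proof -
      obtain q :: rat where q: "f x < of_rat q" "of_rat q < f x + 1 / 2 ^ i"
        using of_rat_dense[of "f x" "f x + 1 / 2 ^ i"] by auto
      obtain k where k: "\<nu> k = q" using \<nu> by (metis bij_pointE)
      let ?e = "min (of_rat q - f x) (f x + 1 / 2 ^ i - of_rat q)"
      obtain n where n: "\<forall>y\<in>X. agree h n x y \<longrightarrow> \<bar>f y - f x\<bar> < ?e"
        using f x q unfolding continuous_on_cylinder_real[OF h] by (meson diff_gt_0_iff_gt min_less_iff_conj)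
      have "y \<in> ?O k" if "y \<in> X" "agree h n x y" for y
        using n[rule_format, OF that] k by (auto simp: abs_if split: if_splits)
      then show ?thesis by blast
    qed
    obtain \<kappa> where "continuous_on X \<kappa>" "\<forall>x\<in>X. x \<in> ?O (\<kappa> x)"
      by (rule continuous_selection_nat[of h X ?O, OF h cov])
    then show ?thesis by blast
  qed
  then obtain r where r: "\<And>i. continuous_on X (r i)"
    "\<And>i x. x \<in> X \<Longrightarrow> \<bar>of_rat (\<nu> (r i x)) - f x\<bar> < 1 / 2 ^ i"
    by (metis (no_types, lifting) mem_Collect_eq)
  have "continuous_on X (\<lambda>x i. r i x)"
    by (rule continuous_on_coordinatewise_then_product[OF r(1)])
  moreover have "rho_name \<nu> (\<lambda>i. r i x) (f x)" if "x \<in> X" for x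
    unfolding rho_name_def using r(2)[OF that] by (simp add: less_imp_le)
  ultimately show ?thesis by blast
qed

text \<open>\<open>G\<close> names all dividends and divisors; \<open>F\<close> reads the answers as
  reals and names the coordinates of \<open>Y\<close>. Names on either side are arbitrary, so
  \<open>sol\<close> asks for admissibility of every name of the result.\<close>

lemma reducible2_by_robust_divisions:
  fixes P :: "('a::topological_space, nat \<Rightarrow> baire) problem" and h :: "'a \<Rightarrow> nat \<Rightarrow> nat"
  assumes h: "cylinder_base h" and \<nu>: "bij \<nu>"
    and x: "\<And>k. continuous_on (pdom P) (x k)" and y: "\<And>k. continuous_on (pdom P) (y k)"
    and xy: "\<And>k w. 0 \<le> x k w \<and> x k w \<le> y k w"
    and Y: "\<And>j. j < m \<Longrightarrow> continuous_on UNIV (\<lambda>q :: point. Y q j)"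
    and sol: "\<And>w q V. w \<in> pdom P \<Longrightarrow> (\<forall>k<K. 0 < y k w \<longrightarrow> q k = x k w / y k w) \<Longrightarrow>
      V \<in> extensional {..<m} \<Longrightarrow> (\<forall>j<m. rho_name \<nu> (V j) (Y q j)) \<Longrightarrow> V \<in> P w"
  shows "P \<le>\<^sub>2 problem_sup {1..} (problem_power (rDiv \<nu>))"
proof -
  \<comment> \<open>The supremum starts at exponent 1 while \<open>K\<close> may be 0, so one
    further division is posed; \<open>xy\<close> makes it admissible.\<close>
  let ?X = "pdom P" and ?Q = "problem_sup {1..} (problem_power (rDiv \<nu>))" and ?K = "Suc K"
  obtain rx where rx: "\<And>k. continuous_on ?X (rx k)" "\<And>k w. w \<in> ?X \<Longrightarrow> rho_name \<nu> (rx k w) (x k w)"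
    using continuous_name_realizer[OF h \<nu> x] by metis
  obtain ry where ry: "\<And>k. continuous_on ?X (ry k)" "\<And>k w. w \<in> ?X \<Longrightarrow> rho_name \<nu> (ry k w) (y k w)"
    using continuous_name_realizer[OF h \<nu> y] by metis
  define G where "G w = (?K, \<lambda>k. if k < ?K then (rx k w, ry k w) else undefined)" for w
  have contG: "continuous_on ?X G"
    unfolding G_def
  proof (intro continuous_on_Pair continuous_on_const continuous_on_coordinatewise_then_product)
    show "continuous_on ?X (\<lambda>w. if k < ?K then (rx k w, ry k w) else undefined)" for k
      by (cases "k < ?K") (auto intro!: continuous_on_Pair rx(1) ry(1))
  qed
  \<comment> \<open>Whatever the input, admissible answers are tuples of names, so \<open>F\<close>
    gets a domain independent of \<open>w\<close>.\<close>
  define DD where "DD = {d :: nat \<Rightarrow> baire. \<forall>k<?K. \<exists>q. rho_name \<nu> (d k) q}"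
  define vals where "vals d = (\<lambda>k. if k < ?K then name_value \<nu> (d k) else 0)" for d :: "nat \<Rightarrow> baire"
  have "continuous_on DD (\<lambda>d. vals d k)" for k
  proof (cases "k < ?K")
    case True
    have "continuous_on DD (\<lambda>d. name_value \<nu> (d k))"
      using True by (intro continuous_on_compose2[OF continuous_name_value]
          continuous_on_subset[OF continuous_on_product_coordinates]) (auto simp: DD_def)
    then show ?thesis using True by (simp add: vals_def)
  qed (simp add: vals_def)
  then have "continuous_on DD vals" by (rule continuous_on_coordinatewise_then_product)
  then have "continuous_on DD (\<lambda>d. Y (vals d) j)" if "j < m" for j
    by (rule continuous_on_compose2[OF Y[OF that]]) auto
  then have "\<exists>r. continuous_on DD r \<and> (\<forall>d\<in>DD. rho_name \<nu> (r d) (Y (vals d) j))" if "j < m" for j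
    using continuous_name_realizer[OF cylinder_base_fun \<nu>] that by blast
  then obtain rY where rY: "\<And>j. j < m \<Longrightarrow> continuous_on DD (rY j)"
    "\<And>j d. j < m \<Longrightarrow> d \<in> DD \<Longrightarrow> rho_name \<nu> (rY j d) (Y (vals d) j)"
    by metis
  define F where "F = (\<lambda>(w :: 'a, d) j. if j < m then rY j d else undefined)"
  have contF: "continuous_on (UNIV \<times> DD) F"
  proof (rule continuous_on_coordinatewise_then_product)
    fix j show "continuous_on (UNIV \<times> DD) (\<lambda>p. F p j)"
    proof (cases "j < m")
      case True
      have "continuous_on (UNIV \<times> DD) (\<lambda>p :: 'a \<times> (nat \<Rightarrow> baire). rY j (snd p))"
        by (rule continuous_on_compose2[OF rY(1)[OF True] continuous_on_snd[OF continuous_on_id]]) auto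
      then show ?thesis using True by (simp add: F_def case_prod_beta)
    qed (simp add: F_def case_prod_beta)
  qed
  have Q: "?Q (G w) = (\<Pi>\<^sub>E k\<in>{..<?K}. rDiv \<nu> (rx k w, ry k w))" for w
  proof -
    have "?Q (G w) = problem_power (rDiv \<nu>) ?K (snd (G w))"
      by (simp add: problem_sup_def G_def del: problem_power.simps)
    also have "\<dots> = (\<Pi>\<^sub>E k\<in>{..<?K}. rDiv \<nu> (snd (G w) k))"
      unfolding problem_power_eq by (simp add: G_def extensional_def)
    also have "\<dots> = (\<Pi>\<^sub>E k\<in>{..<?K}. rDiv \<nu> (rx k w, ry k w))"
      by (rule PiE_cong) (simp add: G_def)
    finally show ?thesis .
  qed
  have "w \<in> ?X \<and> G w \<in> pdom ?Q \<and> (w, g (G w)) \<in> UNIV \<times> DD \<and> F (w, g (G w)) \<in> P w"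
    if g: "g \<in> choice_fns ?Q" and w: "w \<in> ?X" for g w
  proof -
    have "(rx k w, ry k w) \<in> pdom (rDiv \<nu>)" for k
      unfolding pdom_rDiv[OF \<nu>] using rx(2)[OF w] ry(2)[OF w] xy by blast
    then have "rDiv \<nu> (rx k w, ry k w) \<noteq> {}" for k by (simp add: pdom_def)
    then have G: "G w \<in> pdom ?Q" unfolding pdom_def mem_Collect_eq Q by (simp add: PiE_eq_empty_iff)
    define d where "d = g (G w)"
    have "d \<in> ?Q (G w)" using g G by (simp add: choice_fns_def d_def)
    then have d: "d k \<in> rDiv \<nu> (rx k w, ry k w)" if "k < ?K" for k
      unfolding Q using that by (auto simp: PiE_iff)
    have div: "\<exists>q. rho_name \<nu> (d k) q \<and> (0 < y k w \<longrightarrow> q = x k w / y k w)" if k: "k < ?K" for k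
    proof -
      obtain x' y' q where *: "rho_name \<nu> (rx k w) x'" "rho_name \<nu> (ry k w) y'" "rho_name \<nu> (d k) q"
        "0 < y' \<longrightarrow> q = x' / y'" using d[OF k] by (auto simp: rDiv_def)
      have "x' = x k w" "y' = y k w"
        using rho_name_unique[OF *(1) rx(2)[OF w]] rho_name_unique[OF *(2) ry(2)[OF w]] by auto
      then show ?thesis using * by auto
    qed
    then have dDD: "d \<in> DD" by (auto simp: DD_def)
    have "F (w, d) \<in> P w"
    proof (rule sol[OF w, of "vals d"])
      show "\<forall>k<K. 0 < y k w \<longrightarrow> vals d k = x k w / y k w"
      proof (intro allI impI)
        fix k assume k: "k < K" and pos: "0 < y k w"
        then obtain q where "rho_name \<nu> (d k) q" "q = x k w / y k w" using div[of k] by auto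
        then show "vals d k = x k w / y k w" using name_value_eq k by (simp add: vals_def)
      qed
      show "F (w, d) \<in> extensional {..<m}" by (simp add: F_def extensional_def)
      show "\<forall>j<m. rho_name \<nu> (F (w, d) j) (Y (vals d) j)" using rY(2)[OF _ dDD] by (simp add: F_def)
    qed
    then show ?thesis using w G dDD by (simp add: d_def)
  qed
  then show ?thesis
    unfolding reducible2_def using contF contG by blast
qed

text \<open>The reductions for the single indices are glued; as \<open>{i}\<close> is open,
  continuity is checked one index at a time.\<close>

lemma problem_sup_reducible2:
  fixes P :: "'i::topological_space \<Rightarrow> ('a::topological_space, 'b::topological_space) problem"
  assumes discrete: "\<And>i :: 'i. open {i}" and P: "\<And>i. i \<in> I \<Longrightarrow> P i \<le>\<^sub>2 Q"
  shows "problem_sup I P \<le>\<^sub>2 Q"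
proof -
  have "\<forall>i\<in>I. \<exists>F DF G DG. continuous_on DF F \<and> continuous_on DG G \<and>
        (\<forall>g \<in> choice_fns Q. \<forall>w \<in> pdom (P i).
           w \<in> DG \<and> G w \<in> pdom Q \<and> (w, g (G w)) \<in> DF \<and> F (w, g (G w)) \<in> P i w)"
    using P unfolding reducible2_def by blast
  then obtain F DF G DG where
    F: "\<And>i. i \<in> I \<Longrightarrow> continuous_on (DF i) (F i)" and G: "\<And>i. i \<in> I \<Longrightarrow> continuous_on (DG i) (G i)"
    and red: "\<And>i g w. i \<in> I \<Longrightarrow> g \<in> choice_fns Q \<Longrightarrow> w \<in> pdom (P i) \<Longrightarrow>
      w \<in> DG i \<and> G i w \<in> pdom Q \<and> (w, g (G i w)) \<in> DF i \<and> F i (w, g (G i w)) \<in> P i w"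
    by metis
  define F' where "F' = (\<lambda>((i, w), d). F i (w, d))"
  define DF' where "DF' = {((i, w), d). i \<in> I \<and> (w, d) \<in> DF i}"
  define G' where "G' = (\<lambda>(i, w). G i w)"
  define DG' where "DG' = {(i, w). i \<in> I \<and> w \<in> DG i}"
  have "continuous_on DF' F'"
    unfolding continuous_on_topological
  proof (intro ballI allI impI)
    fix p B assume p: "p \<in> DF'" and B: "open B" "F' p \<in> B"
    obtain i w d where iwd: "p = ((i, w), d)" "i \<in> I" "(w, d) \<in> DF i" using p by (auto simp: DF'_def)
    have "F i (w, d) \<in> B" using B(2) by (simp add: F'_def iwd(1))
    then obtain A where A: "open A" "(w, d) \<in> A" "\<forall>q\<in>DF i. q \<in> A \<longrightarrow> F i q \<in> B"
      using F[OF iwd(2), unfolded continuous_on_topological] iwd(3) B(1) by meson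
    let ?A = "(\<lambda>q. fst (fst q)) -` {i} \<inter> (\<lambda>q. (snd (fst q), snd q)) -` A"
    have "open ?A"
      by (intro open_Int open_vimage discrete A(1) continuous_intros)
    then show "\<exists>A. open A \<and> p \<in> A \<and> (\<forall>q\<in>DF'. q \<in> A \<longrightarrow> F' q \<in> B)"
      using A iwd by (intro exI[of _ ?A]) (auto simp: DF'_def F'_def)
  qed
  moreover have "continuous_on DG' G'"
    unfolding continuous_on_topological
  proof (intro ballI allI impI)
    fix p B assume p: "p \<in> DG'" and B: "open B" "G' p \<in> B"
    obtain i w where iw: "p = (i, w)" "i \<in> I" "w \<in> DG i" using p by (auto simp: DG'_def)
    have "G i w \<in> B" using B(2) by (simp add: G'_def iw(1))
    then obtain A where A: "open A" "w \<in> A" "\<forall>q\<in>DG i. q \<in> A \<longrightarrow> G i q \<in> B"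
      using G[OF iw(2), unfolded continuous_on_topological] iw(3) B(1) by meson
    have "open ({i} \<times> A)" by (intro open_Times discrete A(1))
    then show "\<exists>A. open A \<and> p \<in> A \<and> (\<forall>q\<in>DG'. q \<in> A \<longrightarrow> G' q \<in> B)"
      using A iw by (intro exI[of _ "{i} \<times> A"]) (auto simp: DG'_def G'_def)
  qed
  moreover have "p \<in> DG' \<and> G' p \<in> pdom Q \<and> (p, g (G' p)) \<in> DF' \<and> F' (p, g (G' p)) \<in> problem_sup I P p"
    if g: "g \<in> choice_fns Q" and p: "p \<in> pdom (problem_sup I P)" for g p
  proof -
    obtain i w where "p = (i, w)" "i \<in> I" "w \<in> pdom (P i)"
      using p by (cases p) (auto simp: pdom_def problem_sup_def split: if_splits)
    then show ?thesis
      using red[OF _ g] by (simp add: DG'_def G'_def DF'_def F'_def problem_sup_def)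
  qed
  ultimately show ?thesis
    unfolding reducible2_def by blast
qed

text \<open>The bounds on the solution enter as constant rows, which makes the polytope bounded.
  Using \<open>name_value\<close> gives coefficients for every input; they are meaningful and
  continuous on the domain of the problem.\<close>

definition ineq_rows :: "(nat \<Rightarrow> rat) \<Rightarrow> nat \<Rightarrow> nat \<Rightarrow> ((nat \<times> nat \<Rightarrow> baire) \<times> (nat \<Rightarrow> baire)) prow set" where
  "ineq_rows \<nu> n m =
     (\<lambda>i. (\<lambda>w j. if j < m then name_value \<nu> (fst w (i, j)) else 0, \<lambda>w. name_value \<nu> (snd w i))) ` {..<n} \<union>
     (\<lambda>k. (\<lambda>w j. if j = k then - 1 else 0, \<lambda>w. 0)) ` {..<m} \<union>
     (\<lambda>k. (\<lambda>w j. if j = k then 1 else 0, \<lambda>w. 1)) ` {..<m}"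

lemma polytope_of_ineq_rows:
  "x \<in> polytope_of m (inst (ineq_rows \<nu> n m) (U, W)) \<longleftrightarrow>
     (\<forall>i<n. (\<Sum>j<m. name_value \<nu> (U (i, j)) * x j) \<le> name_value \<nu> (W i)) \<and> (\<forall>j<m. 0 \<le> x j \<and> x j \<le> 1)"
proof -
  have "dotp m (\<lambda>j. if j = k then c else 0) x = c * x k" if "k < m" for k c
    using that by (simp add: dotp_def if_distrib[of "\<lambda>t. t * _"] cong: if_cong)
  moreover have "dotp m (\<lambda>j. if j < m then a j else 0) x = (\<Sum>j<m. a j * x j)" for a
    by (simp add: dotp_def)
  ultimately show ?thesis
    unfolding polytope_of_def inst_def ineq_rows_def by (auto simp: ball_Un)
qed

text \<open>Names determine their reals, so the existential quantifiers over matrix and vectors in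
  the problem collapse to the given ones.\<close>

lemma BLinIneq_fixed_iff:
  assumes U: "mat_name \<nu> n m U A" and W: "vec_name \<nu> n W b" and V: "vec_name \<nu> m V v"
  shows "V \<in> BLinIneq_fixed \<nu> n m (U, W) \<longleftrightarrow>
    (\<lambda>j. v $ j) \<in> polytope_of m (inst (ineq_rows \<nu> n m) (U, W))"
proof -
  have A: "A \<in> carrier_mat n m" "\<And>i j. i < n \<Longrightarrow> j < m \<Longrightarrow> name_value \<nu> (U (i, j)) = A $$ (i, j)"
    using U name_value_eq by (auto simp: mat_name_def)
  have b: "b \<in> carrier_vec n" "\<And>i. i < n \<Longrightarrow> name_value \<nu> (W i) = b $ i"
    using W name_value_eq by (auto simp: vec_name_def)
  have v: "v \<in> carrier_vec m" using V by (simp add: vec_name_def)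
  have "A' = A" if "mat_name \<nu> n m U A'" for A'
  proof (rule eq_matI)
    fix i j assume ij: "i < dim_row A" "j < dim_col A"
    then have "rho_name \<nu> (U (i, j)) (A' $$ (i, j))" "rho_name \<nu> (U (i, j)) (A $$ (i, j))"
      using that U by (auto simp: mat_name_def)
    then show "A' $$ (i, j) = A $$ (i, j)" by (rule rho_name_unique)
  qed (use that U in \<open>auto simp: mat_name_def\<close>)
  moreover have "c' = c" if "vec_name \<nu> k Z c'" "vec_name \<nu> k Z c" for k Z c c'
  proof (rule eq_vecI)
    fix i assume "i < dim_vec c"
    then have "rho_name \<nu> (Z i) (c' $ i)" "rho_name \<nu> (Z i) (c $ i)"
      using that by (auto simp: vec_name_def)
    then show "c' $ i = c $ i" by (rule rho_name_unique)
  qed (use that in \<open>auto simp: vec_name_def\<close>)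
  ultimately have "V \<in> BLinIneq_fixed \<nu> n m (U, W) \<longleftrightarrow> A *\<^sub>v v \<le> b \<and> 0\<^sub>v m \<le> v \<and> v \<le> vec m (\<lambda>_. 1)"
    unfolding BLinIneq_fixed_def using U W V by blast
  also have "\<dots> \<longleftrightarrow> (\<lambda>j. v $ j) \<in> polytope_of m (inst (ineq_rows \<nu> n m) (U, W))"
  proof -
    have "(A *\<^sub>v v) $ i = (\<Sum>j<m. name_value \<nu> (U (i, j)) * v $ j)" if "i < n" for i
      using A v that by (auto simp: scalar_prod_def atLeast0LessThan intro!: sum.cong)
    then have "A *\<^sub>v v \<le> b \<longleftrightarrow> (\<forall>i<n. (\<Sum>j<m. name_value \<nu> (U (i, j)) * v $ j) \<le> name_value \<nu> (W i))"
      using A(1) b by (auto simp: less_eq_vec_def simp del: index_mult_mat_vec)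
    moreover have "0\<^sub>v m \<le> v \<and> v \<le> vec m (\<lambda>_. 1) \<longleftrightarrow> (\<forall>j<m. 0 \<le> v $ j \<and> v $ j \<le> 1)"
      using v by (auto simp: less_eq_vec_def)
    ultimately show ?thesis unfolding polytope_of_ineq_rows by blast
  qed
  finally show ?thesis .
qed

lemma BLinIneq_fixed_reducible2:
  assumes \<nu>: "bij \<nu>"
  shows "BLinIneq_fixed \<nu> n m \<le>\<^sub>2 problem_sup {1..} (problem_power (rDiv \<nu>))"
proof -
  let ?X = "pdom (BLinIneq_fixed \<nu> n m)" and ?R = "ineq_rows \<nu> n m" and ?h = "pair_code fun_code fun_code"
  have h: "cylinder_base (?h :: (nat \<times> nat \<Rightarrow> baire) \<times> (nat \<Rightarrow> baire) \<Rightarrow> _)"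
    by (intro cylinder_base_pair cylinder_base_fun)
  have dom: "\<exists>A b V v. mat_name \<nu> n m (fst w) A \<and> vec_name \<nu> n (snd w) b \<and> vec_name \<nu> m V v \<and>
      V \<in> BLinIneq_fixed \<nu> n m w" if w: "w \<in> ?X" for w
  proof -
    obtain V where V: "V \<in> BLinIneq_fixed \<nu> n m w" using w by (auto simp: pdom_def)
    then obtain A b v where "mat_name \<nu> n m (fst w) A" "vec_name \<nu> n (snd w) b" "vec_name \<nu> m V v"
      by (auto simp: BLinIneq_fixed_def split_beta)
    then show ?thesis using V by blast
  qed
  have fin: "finite ?R" by (simp add: ineq_rows_def)
  have names: "\<exists>z. rho_name \<nu> (fst w (i, j)) z" if "w \<in> ?X" "i < n" "j < m" for w i j
    using dom[OF that(1)] that by (auto simp: mat_name_def)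
  have names': "\<exists>z. rho_name \<nu> (snd w i) z" if "w \<in> ?X" "i < n" for w i
    using dom[OF that(1)] that by (auto simp: vec_name_def)
  have coord: "continuous_on ?X (\<lambda>w. fst w p)" "continuous_on ?X (\<lambda>w. snd w i)" for p i
    by (rule continuous_on_product_then_coordinatewise[OF continuous_on_fst[OF continuous_on_id]]
        continuous_on_product_then_coordinatewise[OF continuous_on_snd[OF continuous_on_id]])+
  have cU: "continuous_on ?X (\<lambda>w. name_value \<nu> (fst w (i, j)))" if "i < n" "j < m" for i j
    by (rule continuous_on_compose2[OF continuous_name_value coord(1)]) (use names that in blast)
  have cW: "continuous_on ?X (\<lambda>w. name_value \<nu> (snd w i))" if "i < n" for i
    by (rule continuous_on_compose2[OF continuous_name_value coord(2)]) (use names' that in blast)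
  have cont: "cont_prows ?X ?R"
  proof -
    have "continuous_on ?X (\<lambda>w. if j < m then name_value \<nu> (fst w (i, j)) else 0)" if "i < n" for i j
      using cU[OF that] by (cases "j < m") auto
    then show ?thesis using cW by (auto simp: cont_prows_def ineq_rows_def)
  qed
  have ne: "polytope_of m (inst ?R w) \<noteq> {}" if w: "w \<in> ?X" for w
  proof -
    obtain A b V v where "mat_name \<nu> n m (fst w) A" "vec_name \<nu> n (snd w) b" "vec_name \<nu> m V v"
      "V \<in> BLinIneq_fixed \<nu> n m w" using dom[OF w] by blast
    then have "(\<lambda>j. v $ j) \<in> polytope_of m (inst ?R w)"
      using BLinIneq_fixed_iff[of \<nu> n m "fst w" A "snd w" b V v] by simp
    then show ?thesis by blast
  qed
  have bnd: "\<forall>w\<in>?X. \<forall>x\<in>polytope_of m (inst ?R w). \<forall>j<m. x j \<in> {0..1}"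
    using polytope_of_ineq_rows by auto
  obtain K x y and Y :: "point \<Rightarrow> point" where
    xy: "\<And>k. continuous_on ?X (x k) \<and> continuous_on ?X (y k) \<and> (\<forall>w. 0 \<le> x k w \<and> x k w \<le> y k w)" and
    Y: "\<And>j. j < m \<Longrightarrow> continuous_on UNIV (\<lambda>q. Y q j)" and
    sol: "\<And>w q. w \<in> ?X \<Longrightarrow> (\<forall>k<K. 0 < y k w \<longrightarrow> q k = x k w / y k w) \<Longrightarrow> Y q \<in> polytope_of m (inst ?R w)"
    using polytope_point_by_robust_division[OF h fin cont ne bnd] by blast
  show ?thesis
  proof (rule reducible2_by_robust_divisions[OF h \<nu>, where x = x and y = y and Y = Y and m = m and K = K])
    fix w q V assume w: "w \<in> ?X" and q: "\<forall>k<K. 0 < y k w \<longrightarrow> q k = x k w / y k w"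
      and V: "V \<in> extensional {..<m}" "\<forall>j<m. rho_name \<nu> (V j) (Y q j)"
    obtain A b where Ab: "mat_name \<nu> n m (fst w) A" "vec_name \<nu> n (snd w) b" using dom[OF w] by blast
    \<comment> \<open>\<open>Y q\<close> is cut to its first \<open>m\<close> coordinates, the only
      ones that the polytope constrains.\<close>
    have Vv: "vec_name \<nu> m V (vec m (Y q))" using V by (simp add: vec_name_def)
    have "(\<lambda>j. vec m (Y q) $ j) \<in> polytope_of m (inst ?R w)"
      using sol[OF w q] polytope_of_cong[of m "Y q" "\<lambda>j. vec m (Y q) $ j"] by simp
    then show "V \<in> BLinIneq_fixed \<nu> n m w"
      using BLinIneq_fixed_iff[OF Ab Vv] by simp
  qed (use xy Y in auto)
qed

theorem theorem30:
  fixes \<nu> :: "nat \<Rightarrow> rat"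
  assumes "rat_numbering \<nu>"
  shows "BLinIneq \<nu> \<le>\<^sub>2 problem_sup {1..} (problem_power (rDiv \<nu>))"
  unfolding BLinIneq_def
proof (rule problem_sup_reducible2)
  show "open {p}" for p :: "nat \<times> nat"
  proof -
    have "{p} = {fst p} \<times> {snd p}" by (cases p) simp
    then show ?thesis by (metis open_Times open_discrete)
  qed
  have "bij \<nu>" using assms by (simp add: rat_numbering_def)
  then show "(case p of (n, m) \<Rightarrow> BLinIneq_fixed \<nu> n m) \<le>\<^sub>2 problem_sup {1..} (problem_power (rDiv \<nu>))" for p
    using BLinIneq_fixed_reducible2 by (cases p) simp
qed

end
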